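(* Let $\mathcal{A}\subseteq\mathrm{Fm}_m$ and suppose that there is $n_0\in\mathbb{N}$ such that for every $n\ge n_0$ there exist $m\in\mathbb{N}^+$ and $k\in\mathbb{N}$ with $\vdash_{\mathsf{MLL}_0\oplus\mathcal{A}}(np)^k\to m(p^n)$, where $p$ is a propositional variable. Then $\mathsf{IUL}^\star\oplus\mathcal{A}$ admits a theorem of alternatives and its multiplicative fragment is $\mathsf{MLL}_0^u\oplus\mathcal{A}$.
   Context: A logic over a propositional language $\mathcal{L}$ is a pair $\langle\mathcal{L},\vdash_{\mathsf{L}}\rangle$ where $\vdash_{\mathsf{L}}\subseteq\mathcal{P}(\mathrm{Fm}_{\mathcal{L}})\times\mathrm{Fm}_{\mathcal{L}}$ is a substitution-invariant consequence relation (reflexive, monotone, closed under cut and under substitutions) on the formulas over a fixed countably infinite set of variables; $\vdash_{\mathsf{L}}\varphi$ means $\emptyset\vdash_{\mathsf{L}}\varphi$. $\mathsf{L}'$ is an extension of $\mathsf{L}$ if $\vdash_{\mathsf{L}}\subseteq\vdash_{\mathsf{L}'}$; for a set $X$ of formulas, $\mathsf{L}\oplus X$ is the smallest extension of $\mathsf{L}$ that includes $X$ (as theorems). The language $\mathcal{L}_m$ has binary connectives $\to,\cdot$ and constants $1,0$; set $\neg\varphi:=\varphi\to 0$, $\varphi+\psi:=\neg\varphi\to\psi$, $0\varphi:=0$, $(n+1)\varphi:=n\varphi+\varphi$, $\varphi^0:=1$, $\varphi^{n+1}:=\varphi^n\cdot\varphi$. Formulas of $\mathcal{L}_m$ are multiplicative;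 their set is $\mathrm{Fm}_m$. $\mathsf{MLL}$ is the logic over $\mathcal{L}_m$ given by the axiom schemas $(\varphi\to\psi)\to((\psi\to\chi)\to(\varphi\to\chi))$, $(\varphi\to(\psi\to\chi))\to(\psi\to(\varphi\to\chi))$, $\varphi\to\varphi$, $\neg\neg\varphi\to\varphi$, $(\varphi\to(\psi\to\chi))\to((\varphi\cdot\psi)\to\chi)$, $\varphi\to(\psi\to(\varphi\cdot\psi))$, $\varphi\to(1\to\varphi)$, $1$, and the rule modus ponens. $\mathsf{MLL}^u$ is $\mathsf{MLL}$ extended with the rules "from $n\varphi$ infer $\varphi$" for each $n\in\mathbb{N}^+$. $\mathsf{MLL}_0:=\mathsf{MLL}\oplus\{0\to1\}$ and $\mathsf{MLL}_0^u:=\mathsf{MLL}^u\oplus\{0\to1\}$. The language $\mathcal{L}_\ell$ extends $\mathcal{L}_m$ with binary $\land,\lor$. $\mathsf{MALL}^-$ is the logic over $\mathcal{L}_\ell$ given by the axioms of $\mathsf{MLL}$ plus $(\varphi\land\psi)\to\varphi$, $(\varphi\land\psi)\to\psi$, $\varphi\to(\varphi\lor\psi)$, $\psi\to(\varphi\lor\psi)$, $((\varphi\to\psi)\land(\varphi\to\chi))\to(\varphi\to(\psi\land\chi))$, $((\varphi\to\chi)\land(\psi\to\chi))\to((\varphi\lor\psi)\to\chi)$, with rules modus ponens and adjunction (from $\varphi,\psi$ infer $\varphi\land\psi$). $\mathsf{IUL}^-:=\mathsf{MALL}^-\oplus\{((p\to q)\land 1)\lor((q\to p)\land 1)\}$ and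 $\mathsf{IUL}^\star:=\mathsf{IUL}^-\oplus\{p\lor\neg p,\ 0\to1\}$. The multiplicative fragment of an extension $\mathsf{L}$ of $\mathsf{MALL}^-$ is the logic over $\mathcal{L}_m$ with consequence relation $\vdash_{\mathsf{L}}\cap(\mathcal{P}(\mathrm{Fm}_m)\times\mathrm{Fm}_m)$. An extension $\mathsf{L}$ of $\mathsf{IUL}^-$ admits a theorem of alternatives if for all $\Sigma\cup\{\varphi_1,\dots,\varphi_n\}\subseteq\mathrm{Fm}_m$: $\Sigma\vdash_{\mathsf{L}}\varphi_1\lor\dots\lor\varphi_n$ iff $\Sigma\vdash_{\mathsf{L}}\lambda_1\varphi_1+\dots+\lambda_n\varphi_n$ for some $\lambda_1,\dots,\lambda_n\in\mathbb{N}$ not all $0$. *)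

theory Defs
  imports Main
begin

datatype fm =
    Var nat
  | Imp fm fm  (infixr \<open>\<rightarrow>\<close> 55)
  | Fus fm fm  (infixl \<open>\<odot>\<close> 70)
  | One  (\<open>\<one>\<close>)
  | Zero  (\<open>\<zero>\<close>)
  | Conj fm fm  (infixl \<open>\<^bold>\<and>\<close> 62)
  | Disj fm fm  (infixl \<open>\<^bold>\<or>\<close> 60)

primrec multiplicative :: "fm \<Rightarrow> bool" where
  "multiplicative (Var x) = True"
| "multiplicative (\<phi> \<rightarrow> \<psi>) = (multiplicative \<phi> \<and> multiplicative \<psi>)"
| "multiplicative (\<phi> \<odot> \<psi>) = (multiplicative \<phi> \<and> multiplicative \<psi>)"
| "multiplicative \<one> = True"
| "multiplicative \<zero> = True"
| "multiplicative (\<phi> \<^bold>\<and> \<psi>) = False"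
| "multiplicative (\<phi> \<^bold>\<or> \<psi>) = False"

text \<open>Both languages share one type of formulas: a language is given by its set of
  formulas, either \<open>Fm_m\<close> or \<open>Fm_l\<close>.\<close>

definition Fm_m :: "fm set" where "Fm_m = {\<phi>. multiplicative \<phi>}"

definition Fm_l :: "fm set" where "Fm_l = UNIV"

definition Neg :: "fm \<Rightarrow> fm"  (\<open>\<^bold>\<not> _\<close> [80] 80) where "\<^bold>\<not> \<phi> = \<phi> \<rightarrow> \<zero>"

definition Plus :: "fm \<Rightarrow> fm \<Rightarrow> fm"  (infixl \<open>\<^bold>+\<close> 65) where "\<phi> \<^bold>+ \<psi> = \<^bold>\<not> \<phi> \<rightarrow> \<psi>"

primrec mult :: "nat \<Rightarrow> fm \<Rightarrow> fm" where
  "mult 0 \<phi> = \<zero>"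
| "mult (Suc n) \<phi> = mult n \<phi> \<^bold>+ \<phi>"

primrec pow :: "fm \<Rightarrow> nat \<Rightarrow> fm" where
  "pow \<phi> 0 = \<one>"
| "pow \<phi> (Suc n) = pow \<phi> n \<odot> \<phi>"

text \<open>Finite sums and disjunctions of nonempty lists, bracketed to the left
  (in particular \<open>Plus_list [\<phi>] = \<phi>\<close> and \<open>Disj_list [\<phi>] = \<phi>\<close>).\<close>

definition Plus_list :: "fm list \<Rightarrow> fm" where
  "Plus_list \<phi>s = foldl Plus (hd \<phi>s) (tl \<phi>s)"

definition Disj_list :: "fm list \<Rightarrow> fm" where
  "Disj_list \<phi>s = foldl Disj (hd \<phi>s) (tl \<phi>s)"

primrec subst :: "(nat \<Rightarrow> fm) \<Rightarrow> fm \<Rightarrow> fm" where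
  "subst \<sigma> (Var x) = \<sigma> x"
| "subst \<sigma> (\<phi> \<rightarrow> \<psi>) = subst \<sigma> \<phi> \<rightarrow> subst \<sigma> \<psi>"
| "subst \<sigma> (\<phi> \<odot> \<psi>) = subst \<sigma> \<phi> \<odot> subst \<sigma> \<psi>"
| "subst \<sigma> \<one> = \<one>"
| "subst \<sigma> \<zero> = \<zero>"
| "subst \<sigma> (\<phi> \<^bold>\<and> \<psi>) = subst \<sigma> \<phi> \<^bold>\<and> subst \<sigma> \<psi>"
| "subst \<sigma> (\<phi> \<^bold>\<or> \<psi>) = subst \<sigma> \<phi> \<^bold>\<or> subst \<sigma> \<psi>"

type_synonym crel = "(fm set \<times> fm) set"

abbreviation entails :: "fm set \<Rightarrow> crel \<Rightarrow> fm \<Rightarrow> bool"  (\<open>_ \<turnstile>\<^bsub>_\<^esub> _\<close> [51, 0, 51] 50) where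
  "\<Gamma> \<turnstile>\<^bsub>L\<^esub> \<phi> \<equiv> (\<Gamma>, \<phi>) \<in> L"

definition logic_over :: "fm set \<Rightarrow> crel \<Rightarrow> bool" where
  "logic_over F L \<longleftrightarrow>
     L \<subseteq> Pow F \<times> F \<and>
     (\<forall>\<Gamma> \<phi>. \<Gamma> \<subseteq> F \<longrightarrow> \<phi> \<in> \<Gamma> \<longrightarrow> \<Gamma> \<turnstile>\<^bsub>L\<^esub> \<phi>) \<and>
     (\<forall>\<Gamma> \<Delta> \<phi>. \<Gamma> \<turnstile>\<^bsub>L\<^esub> \<phi> \<longrightarrow> \<Gamma> \<subseteq> \<Delta> \<longrightarrow> \<Delta> \<subseteq> F \<longrightarrow> \<Delta> \<turnstile>\<^bsub>L\<^esub> \<phi>) \<and>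
     (\<forall>\<Gamma> \<Delta> \<phi>. \<Gamma> \<subseteq> F \<longrightarrow> (\<forall>\<psi>\<in>\<Delta>. \<Gamma> \<turnstile>\<^bsub>L\<^esub> \<psi>) \<longrightarrow> \<Delta> \<turnstile>\<^bsub>L\<^esub> \<phi> \<longrightarrow> \<Gamma> \<turnstile>\<^bsub>L\<^esub> \<phi>) \<and>
     (\<forall>\<Gamma> \<phi> \<sigma>. range \<sigma> \<subseteq> F \<longrightarrow> \<Gamma> \<turnstile>\<^bsub>L\<^esub> \<phi> \<longrightarrow> (subst \<sigma> ` \<Gamma>) \<turnstile>\<^bsub>L\<^esub> (subst \<sigma> \<phi>))"

text \<open>\<open>oplus F L X\<close> is \<open>L \<oplus> X\<close> formed among the logics over the language \<open>F\<close>.\<close>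

definition oplus :: "fm set \<Rightarrow> crel \<Rightarrow> fm set \<Rightarrow> crel" where
  "oplus F L X = \<Inter> {L'. logic_over F L' \<and> L \<subseteq> L' \<and> (\<forall>\<phi>\<in>X. {} \<turnstile>\<^bsub>L'\<^esub> \<phi>)}"

inductive derives :: "fm set \<Rightarrow> (fm set \<times> fm) set \<Rightarrow> fm set \<Rightarrow> fm \<Rightarrow> bool"
  for Ax :: "fm set" and R :: "(fm set \<times> fm) set" and \<Gamma> :: "fm set" where
  hypothesis: "\<phi> \<in> \<Gamma> \<Longrightarrow> derives Ax R \<Gamma> \<phi>"
| axiom: "\<phi> \<in> Ax \<Longrightarrow> derives Ax R \<Gamma> \<phi>"
| rule: "(\<Delta>, \<phi>) \<in> R \<Longrightarrow> (\<And>\<psi>. \<psi> \<in> \<Delta> \<Longrightarrow> derives Ax R \<Gamma> \<psi>) \<Longrightarrow> derives Ax R \<Gamma> \<phi>"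

definition axiomatized :: "fm set \<Rightarrow> fm set \<Rightarrow> (fm set \<times> fm) set \<Rightarrow> crel" where
  "axiomatized F Ax R = {(\<Gamma>, \<phi>). \<Gamma> \<subseteq> F \<and> derives Ax R \<Gamma> \<phi>}"

text \<open>Axiom schemas and rules are parametrized by the language \<open>F\<close> their instances range over.\<close>

inductive_set ax_MLL :: "fm set \<Rightarrow> fm set" for F :: "fm set" where
  "\<lbrakk>\<phi> \<in> F; \<psi> \<in> F; \<chi> \<in> F\<rbrakk> \<Longrightarrow> (\<phi> \<rightarrow> \<psi>) \<rightarrow> ((\<psi> \<rightarrow> \<chi>) \<rightarrow> (\<phi> \<rightarrow> \<chi>)) \<in> ax_MLL F"
| "\<lbrakk>\<phi> \<in> F; \<psi> \<in> F; \<chi> \<in> F\<rbrakk> \<Longrightarrow> (\<phi> \<rightarrow> (\<psi> \<rightarrow> \<chi>)) \<rightarrow> (\<psi> \<rightarrow> (\<phi> \<rightarrow> \<chi>)) \<in> ax_MLL F"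
| "\<phi> \<in> F \<Longrightarrow> \<phi> \<rightarrow> \<phi> \<in> ax_MLL F"
| "\<phi> \<in> F \<Longrightarrow> \<^bold>\<not> \<^bold>\<not> \<phi> \<rightarrow> \<phi> \<in> ax_MLL F"
| "\<lbrakk>\<phi> \<in> F; \<psi> \<in> F; \<chi> \<in> F\<rbrakk> \<Longrightarrow> (\<phi> \<rightarrow> (\<psi> \<rightarrow> \<chi>)) \<rightarrow> ((\<phi> \<odot> \<psi>) \<rightarrow> \<chi>) \<in> ax_MLL F"
| "\<lbrakk>\<phi> \<in> F; \<psi> \<in> F\<rbrakk> \<Longrightarrow> \<phi> \<rightarrow> (\<psi> \<rightarrow> (\<phi> \<odot> \<psi>)) \<in> ax_MLL F"
| "\<phi> \<in> F \<Longrightarrow> \<phi> \<rightarrow> (\<one> \<rightarrow> \<phi>) \<in> ax_MLL F"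
| "\<one> \<in> ax_MLL F"

inductive_set ax_lattice :: "fm set \<Rightarrow> fm set" for F :: "fm set" where
  "\<lbrakk>\<phi> \<in> F; \<psi> \<in> F\<rbrakk> \<Longrightarrow> (\<phi> \<^bold>\<and> \<psi>) \<rightarrow> \<phi> \<in> ax_lattice F"
| "\<lbrakk>\<phi> \<in> F; \<psi> \<in> F\<rbrakk> \<Longrightarrow> (\<phi> \<^bold>\<and> \<psi>) \<rightarrow> \<psi> \<in> ax_lattice F"
| "\<lbrakk>\<phi> \<in> F; \<psi> \<in> F\<rbrakk> \<Longrightarrow> \<phi> \<rightarrow> (\<phi> \<^bold>\<or> \<psi>) \<in> ax_lattice F"
| "\<lbrakk>\<phi> \<in> F; \<psi> \<in> F\<rbrakk> \<Longrightarrow> \<psi> \<rightarrow> (\<phi> \<^bold>\<or> \<psi>) \<in> ax_lattice F"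
| "\<lbrakk>\<phi> \<in> F; \<psi> \<in> F; \<chi> \<in> F\<rbrakk> \<Longrightarrow> ((\<phi> \<rightarrow> \<psi>) \<^bold>\<and> (\<phi> \<rightarrow> \<chi>)) \<rightarrow> (\<phi> \<rightarrow> (\<psi> \<^bold>\<and> \<chi>)) \<in> ax_lattice F"
| "\<lbrakk>\<phi> \<in> F; \<psi> \<in> F; \<chi> \<in> F\<rbrakk> \<Longrightarrow> ((\<phi> \<rightarrow> \<chi>) \<^bold>\<and> (\<psi> \<rightarrow> \<chi>)) \<rightarrow> ((\<phi> \<^bold>\<or> \<psi>) \<rightarrow> \<chi>) \<in> ax_lattice F"

definition rule_MP :: "fm set \<Rightarrow> (fm set \<times> fm) set" where
  "rule_MP F = {({\<phi>, \<phi> \<rightarrow> \<psi>}, \<psi>) | \<phi> \<psi>. \<phi> \<in> F \<and> \<psi> \<in> F}"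

definition rule_adj :: "fm set \<Rightarrow> (fm set \<times> fm) set" where
  "rule_adj F = {({\<phi>, \<psi>}, \<phi> \<^bold>\<and> \<psi>) | \<phi> \<psi>. \<phi> \<in> F \<and> \<psi> \<in> F}"

definition rule_u :: "fm set \<Rightarrow> (fm set \<times> fm) set" where
  "rule_u F = {({mult n \<phi>}, \<phi>) | n \<phi>. n \<ge> 1 \<and> \<phi> \<in> F}"

definition MLL :: crel where
  "MLL = axiomatized Fm_m (ax_MLL Fm_m) (rule_MP Fm_m)"

definition MLLu :: crel where
  "MLLu = axiomatized Fm_m (ax_MLL Fm_m) (rule_MP Fm_m \<union> rule_u Fm_m)"

definition MLL0 :: crel where
  "MLL0 = oplus Fm_m MLL {\<zero> \<rightarrow> \<one>}"

definition MLL0u :: crel where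
  "MLL0u = oplus Fm_m MLLu {\<zero> \<rightarrow> \<one>}"

definition MALLminus :: crel where
  "MALLminus = axiomatized Fm_l (ax_MLL Fm_l \<union> ax_lattice Fm_l) (rule_MP Fm_l \<union> rule_adj Fm_l)"

definition IULminus :: crel where
  "IULminus = oplus Fm_l MALLminus
     {((Var 0 \<rightarrow> Var 1) \<^bold>\<and> \<one>) \<^bold>\<or> ((Var 1 \<rightarrow> Var 0) \<^bold>\<and> \<one>)}"

definition IULstar :: crel where
  "IULstar = oplus Fm_l IULminus {Var 0 \<^bold>\<or> \<^bold>\<not> (Var 0), \<zero> \<rightarrow> \<one>}"

definition mult_fragment :: "crel \<Rightarrow> crel" where
  "mult_fragment L = L \<inter> (Pow Fm_m \<times> Fm_m)"

definition admits_theorem_of_alternatives :: "crel \<Rightarrow> bool" where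
  "admits_theorem_of_alternatives L \<longleftrightarrow>
     (\<forall>\<Sigma> \<phi>s. \<Sigma> \<subseteq> Fm_m \<longrightarrow> set \<phi>s \<subseteq> Fm_m \<longrightarrow> \<phi>s \<noteq> [] \<longrightarrow>
        (\<Sigma> \<turnstile>\<^bsub>L\<^esub> Disj_list \<phi>s \<longleftrightarrow>
         (\<exists>ls. length ls = length \<phi>s \<and> (\<exists>l\<in>set ls. l \<noteq> 0) \<and>
               \<Sigma> \<turnstile>\<^bsub>L\<^esub> Plus_list (map2 mult ls \<phi>s))))"

text \<open>The constructions above do yield logics, and \<open>oplus\<close> is the least extension.\<close>

lemma subst_defined [simp]:
  "subst \<sigma> (\<^bold>\<not> \<phi>) = \<^bold>\<not> (subst \<sigma> \<phi>)"
  "subst \<sigma> (\<phi> \<^bold>+ \<psi>) = subst \<sigma> \<phi> \<^bold>+ subst \<sigma> \<psi>"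
  "subst \<sigma> (mult n \<phi>) = mult n (subst \<sigma> \<phi>)"
  "subst \<sigma> (pow \<phi> n) = pow (subst \<sigma> \<phi>) n"
proof -
  show neg: "subst \<sigma> (\<^bold>\<not> \<phi>) = \<^bold>\<not> (subst \<sigma> \<phi>)" for \<phi> by (simp add: Neg_def)
  show plus: "subst \<sigma> (\<phi> \<^bold>+ \<psi>) = subst \<sigma> \<phi> \<^bold>+ subst \<sigma> \<psi>" for \<phi> \<psi>
    by (simp add: Plus_def neg)
  show "subst \<sigma> (mult n \<phi>) = mult n (subst \<sigma> \<phi>)" by (induction n) (simp_all add: plus)
  show "subst \<sigma> (pow \<phi> n) = pow (subst \<sigma> \<phi>) n" by (induction n) simp_all
qed

lemma Fm_m_simps [simp]:
  "Var x \<in> Fm_m" "\<one> \<in> Fm_m" "\<zero> \<in> Fm_m"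
  "\<phi> \<rightarrow> \<psi> \<in> Fm_m \<longleftrightarrow> \<phi> \<in> Fm_m \<and> \<psi> \<in> Fm_m"
  "\<phi> \<odot> \<psi> \<in> Fm_m \<longleftrightarrow> \<phi> \<in> Fm_m \<and> \<psi> \<in> Fm_m"
  "\<^bold>\<not> \<phi> \<in> Fm_m \<longleftrightarrow> \<phi> \<in> Fm_m"
  by (auto simp: Fm_m_def Neg_def)

lemma subst_Fm_m: "range \<sigma> \<subseteq> Fm_m \<Longrightarrow> \<phi> \<in> Fm_m \<Longrightarrow> subst \<sigma> \<phi> \<in> Fm_m"
  unfolding Fm_m_def by (induction \<phi>) auto

lemma ax_MLL_subst:
  assumes "\<And>\<phi>. \<phi> \<in> F \<Longrightarrow> subst \<sigma> \<phi> \<in> F" "\<phi> \<in> ax_MLL F"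
  shows "subst \<sigma> \<phi> \<in> ax_MLL F"
  using assms(2) by cases (auto intro: ax_MLL.intros assms(1))

lemma ax_lattice_subst:
  assumes "\<And>\<phi>. \<phi> \<in> F \<Longrightarrow> subst \<sigma> \<phi> \<in> F" "\<phi> \<in> ax_lattice F"
  shows "subst \<sigma> \<phi> \<in> ax_lattice F"
  using assms(2) by cases (auto intro: ax_lattice.intros assms(1))

lemma derives_cut:
  assumes "derives Ax R \<Delta> \<phi>" "\<And>\<psi>. \<psi> \<in> \<Delta> \<Longrightarrow> derives Ax R \<Gamma> \<psi>"
  shows "derives Ax R \<Gamma> \<phi>"
  using assms(1) by induction (auto intro: derives.intros assms(2))

lemma derives_subst:
  assumes "derives Ax R \<Gamma> \<phi>"
    and ax: "\<And>\<phi>. \<phi> \<in> Ax \<Longrightarrow> subst \<sigma> \<phi> \<in> Ax"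
    and ru: "\<And>\<Delta> \<phi>. (\<Delta>, \<phi>) \<in> R \<Longrightarrow> (subst \<sigma> ` \<Delta>, subst \<sigma> \<phi>) \<in> R"
  shows "derives Ax R (subst \<sigma> ` \<Gamma>) (subst \<sigma> \<phi>)"
  using assms(1)
proof induction
  case (rule \<Delta> \<phi>)
  show ?case by (rule derives.rule[OF ru[OF rule(1)]]) (use rule in auto)
qed (auto intro: derives.intros ax)

lemma logic_over_axiomatized:
  assumes F: "\<And>\<sigma> \<phi>. range \<sigma> \<subseteq> F \<Longrightarrow> \<phi> \<in> F \<Longrightarrow> subst \<sigma> \<phi> \<in> F"
    and "Ax \<subseteq> F" "R \<subseteq> Pow F \<times> F"
    and ax: "\<And>\<sigma> \<phi>. range \<sigma> \<subseteq> F \<Longrightarrow> \<phi> \<in> Ax \<Longrightarrow> subst \<sigma> \<phi> \<in> Ax"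
    and ru: "\<And>\<sigma> \<Delta> \<phi>. range \<sigma> \<subseteq> F \<Longrightarrow> (\<Delta>, \<phi>) \<in> R \<Longrightarrow> (subst \<sigma> ` \<Delta>, subst \<sigma> \<phi>) \<in> R"
  shows "logic_over F (axiomatized F Ax R)"
proof -
  have inF: "\<phi> \<in> F" if "derives Ax R \<Gamma> \<phi>" "\<Gamma> \<subseteq> F" for \<Gamma> \<phi>
    using that assms(2,3) by (induction) auto
  have mono: "derives Ax R \<Delta> \<phi>" if "derives Ax R \<Gamma> \<phi>" "\<Gamma> \<subseteq> \<Delta>" for \<Gamma> \<Delta> \<phi>
    using derives_cut[OF that(1)] that(2) by (blast intro: derives.hypothesis)
  have cut: "derives Ax R \<Gamma> \<phi>" if "derives Ax R \<Delta> \<phi>" "\<forall>\<psi>\<in>\<Delta>. derives Ax R \<Gamma> \<psi>" for \<Gamma> \<Delta> \<phi>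
    using derives_cut[OF that(1)] that(2) by blast
  have sub: "derives Ax R (subst \<sigma> ` \<Gamma>) (subst \<sigma> \<phi>)"
    if "range \<sigma> \<subseteq> F" "derives Ax R \<Gamma> \<phi>" for \<sigma> \<Gamma> \<phi>
    using derives_subst[OF that(2)] ax[OF that(1)] ru[OF that(1)] by blast
  show ?thesis
    unfolding logic_over_def axiomatized_def
  proof (intro conjI allI impI)
    show "{(\<Gamma>, \<phi>). \<Gamma> \<subseteq> F \<and> derives Ax R \<Gamma> \<phi>} \<subseteq> Pow F \<times> F"
      using inF by auto
  next
    fix \<Gamma> and \<phi> :: fm assume "\<Gamma> \<subseteq> F" "\<phi> \<in> \<Gamma>"
    then show "\<Gamma> \<turnstile>\<^bsub>{(\<Gamma>, \<phi>). \<Gamma> \<subseteq> F \<and> derives Ax R \<Gamma> \<phi>}\<^esub> \<phi>"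
      by (simp add: derives.hypothesis)
  next
    fix \<Gamma> \<Delta> \<phi>
    assume "\<Gamma> \<turnstile>\<^bsub>{(\<Gamma>, \<phi>). \<Gamma> \<subseteq> F \<and> derives Ax R \<Gamma> \<phi>}\<^esub> \<phi>" "\<Gamma> \<subseteq> \<Delta>" "\<Delta> \<subseteq> F"
    then show "\<Delta> \<turnstile>\<^bsub>{(\<Gamma>, \<phi>). \<Gamma> \<subseteq> F \<and> derives Ax R \<Gamma> \<phi>}\<^esub> \<phi>"
      using mono[of \<Gamma> \<phi> \<Delta>] by simp
  next
    fix \<Gamma> \<Delta> \<phi>
    assume "\<Gamma> \<subseteq> F" "\<forall>\<psi>\<in>\<Delta>. \<Gamma> \<turnstile>\<^bsub>{(\<Gamma>, \<phi>). \<Gamma> \<subseteq> F \<and> derives Ax R \<Gamma> \<phi>}\<^esub> \<psi>"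
      "\<Delta> \<turnstile>\<^bsub>{(\<Gamma>, \<phi>). \<Gamma> \<subseteq> F \<and> derives Ax R \<Gamma> \<phi>}\<^esub> \<phi>"
    then show "\<Gamma> \<turnstile>\<^bsub>{(\<Gamma>, \<phi>). \<Gamma> \<subseteq> F \<and> derives Ax R \<Gamma> \<phi>}\<^esub> \<phi>"
      using cut[of \<Delta> \<phi> \<Gamma>] by simp
  next
    fix \<Gamma> \<phi> and \<sigma> :: "nat \<Rightarrow> fm"
    assume a: "range \<sigma> \<subseteq> F" "\<Gamma> \<turnstile>\<^bsub>{(\<Gamma>, \<phi>). \<Gamma> \<subseteq> F \<and> derives Ax R \<Gamma> \<phi>}\<^esub> \<phi>"
    then have "subst \<sigma> ` \<Gamma> \<subseteq> F" using F[OF a(1)] by blast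
    with a show "(subst \<sigma> ` \<Gamma>) \<turnstile>\<^bsub>{(\<Gamma>, \<phi>). \<Gamma> \<subseteq> F \<and> derives Ax R \<Gamma> \<phi>}\<^esub> (subst \<sigma> \<phi>)"
      using sub[of \<sigma> \<Gamma> \<phi>] by simp
  qed
qed

lemma rule_subst:
  assumes "\<And>\<phi>. \<phi> \<in> F \<Longrightarrow> subst \<sigma> \<phi> \<in> F"
  shows "(\<Delta>, \<phi>) \<in> rule_MP F \<Longrightarrow> (subst \<sigma> ` \<Delta>, subst \<sigma> \<phi>) \<in> rule_MP F"
    and "(\<Delta>, \<phi>) \<in> rule_adj F \<Longrightarrow> (subst \<sigma> ` \<Delta>, subst \<sigma> \<phi>) \<in> rule_adj F"
    and "(\<Delta>, \<phi>) \<in> rule_u F \<Longrightarrow> (subst \<sigma> ` \<Delta>, subst \<sigma> \<phi>) \<in> rule_u F"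
proof -
  assume "(\<Delta>, \<phi>) \<in> rule_MP F"
  then obtain \<psi> where "\<Delta> = {\<psi>, \<psi> \<rightarrow> \<phi>}" "\<psi> \<in> F" "\<phi> \<in> F"
    by (auto simp: rule_MP_def)
  then show "(subst \<sigma> ` \<Delta>, subst \<sigma> \<phi>) \<in> rule_MP F"
    unfolding rule_MP_def by (auto intro!: exI[of _ "subst \<sigma> \<psi>"] assms)
next
  assume "(\<Delta>, \<phi>) \<in> rule_adj F"
  then obtain \<psi> \<chi> where "\<Delta> = {\<psi>, \<chi>}" "\<phi> = \<psi> \<^bold>\<and> \<chi>" "\<psi> \<in> F" "\<chi> \<in> F"
    by (auto simp: rule_adj_def)
  then show "(subst \<sigma> ` \<Delta>, subst \<sigma> \<phi>) \<in> rule_adj F"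
    unfolding rule_adj_def by (auto intro!: assms)
next
  assume "(\<Delta>, \<phi>) \<in> rule_u F"
  then obtain n where "\<Delta> = {mult n \<phi>}" "n \<ge> 1" "\<phi> \<in> F"
    by (auto simp: rule_u_def)
  then show "(subst \<sigma> ` \<Delta>, subst \<sigma> \<phi>) \<in> rule_u F"
    unfolding rule_u_def by (auto intro!: exI[of _ n] assms)
qed

lemma ax_MLL_Fm_m: "\<phi> \<in> ax_MLL Fm_m \<Longrightarrow> \<phi> \<in> Fm_m"
  by (erule ax_MLL.cases) simp_all

lemma mult_Fm_m: "\<phi> \<in> Fm_m \<Longrightarrow> mult n \<phi> \<in> Fm_m"
  by (induction n) (simp_all add: Plus_def)

lemma logic_over_MLL: "logic_over Fm_m MLL"
  unfolding MLL_def
proof (rule logic_over_axiomatized)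
  show "rule_MP Fm_m \<subseteq> Pow Fm_m \<times> Fm_m" by (auto simp: rule_MP_def)
qed (auto intro: subst_Fm_m ax_MLL_subst ax_MLL_Fm_m rule_subst(1))

lemma logic_over_MLLu: "logic_over Fm_m MLLu"
  unfolding MLLu_def
proof (rule logic_over_axiomatized)
  show "rule_MP Fm_m \<union> rule_u Fm_m \<subseteq> Pow Fm_m \<times> Fm_m"
    by (auto simp: rule_MP_def rule_u_def mult_Fm_m)
qed (auto intro: subst_Fm_m ax_MLL_subst ax_MLL_Fm_m rule_subst(1,3))

lemma logic_over_MALLminus: "logic_over Fm_l MALLminus"
  unfolding MALLminus_def
  by (rule logic_over_axiomatized)
    (auto intro: ax_MLL_subst ax_lattice_subst rule_subst(1,2) simp: Fm_l_def)

lemma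
  assumes "logic_over F L"
  shows logic_over_refl: "\<Gamma> \<subseteq> F \<Longrightarrow> \<phi> \<in> \<Gamma> \<Longrightarrow> \<Gamma> \<turnstile>\<^bsub>L\<^esub> \<phi>"
    and logic_over_mono: "\<Gamma> \<turnstile>\<^bsub>L\<^esub> \<phi> \<Longrightarrow> \<Gamma> \<subseteq> \<Delta> \<Longrightarrow> \<Delta> \<subseteq> F \<Longrightarrow> \<Delta> \<turnstile>\<^bsub>L\<^esub> \<phi>"
    and logic_over_cut: "\<Gamma> \<subseteq> F \<Longrightarrow> \<forall>\<psi>\<in>\<Delta>. \<Gamma> \<turnstile>\<^bsub>L\<^esub> \<psi> \<Longrightarrow> \<Delta> \<turnstile>\<^bsub>L\<^esub> \<phi> \<Longrightarrow> \<Gamma> \<turnstile>\<^bsub>L\<^esub> \<phi>"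
    and logic_over_subst:
      "range \<sigma> \<subseteq> F \<Longrightarrow> \<Gamma> \<turnstile>\<^bsub>L\<^esub> \<phi> \<Longrightarrow> (subst \<sigma> ` \<Gamma>) \<turnstile>\<^bsub>L\<^esub> (subst \<sigma> \<phi>)"
  using assms unfolding logic_over_def by (elim conjE, iprover)+

lemma logic_over_oplus:
  assumes F: "\<And>\<sigma> \<phi>. range \<sigma> \<subseteq> F \<Longrightarrow> \<phi> \<in> F \<Longrightarrow> subst \<sigma> \<phi> \<in> F"
    and "L \<subseteq> Pow F \<times> F" "X \<subseteq> F"
  shows "logic_over F (oplus F L X)"
proof -
  let ?S = "{L'. logic_over F L' \<and> L \<subseteq> L' \<and> (\<forall>\<phi>\<in>X. {} \<turnstile>\<^bsub>L'\<^esub> \<phi>)}"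
  have top: "Pow F \<times> F \<in> ?S"
    using assms(2,3) unfolding logic_over_def by (auto simp: image_subset_iff intro!: F)
  have S: "logic_over F L'" if "L' \<in> ?S" for L' using that by simp
  show ?thesis
    unfolding logic_over_def[of F "oplus F L X"] unfolding oplus_def
  proof (intro conjI allI impI)
    show "\<Inter> ?S \<subseteq> Pow F \<times> F" using top by (rule Inter_lower)
  next
    fix \<Gamma> and \<phi> :: fm assume a: "\<Gamma> \<subseteq> F" "\<phi> \<in> \<Gamma>"
    show "\<Gamma> \<turnstile>\<^bsub>\<Inter> ?S\<^esub> \<phi>"
    proof
      fix L' assume L': "L' \<in> ?S"
      show "\<Gamma> \<turnstile>\<^bsub>L'\<^esub> \<phi>" using S[OF L'] a by (rule logic_over_refl)
    qed
  next
    fix \<Gamma> \<Delta> \<phi> assume a: "\<Gamma> \<turnstile>\<^bsub>\<Inter> ?S\<^esub> \<phi>" "\<Gamma> \<subseteq> \<Delta>" "\<Delta> \<subseteq> F"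
    show "\<Delta> \<turnstile>\<^bsub>\<Inter> ?S\<^esub> \<phi>"
    proof
      fix L' assume L': "L' \<in> ?S"
      with a(1) have "\<Gamma> \<turnstile>\<^bsub>L'\<^esub> \<phi>" by (rule InterD)
      from S[OF L'] this a(2,3) show "\<Delta> \<turnstile>\<^bsub>L'\<^esub> \<phi>" by (rule logic_over_mono)
    qed
  next
    fix \<Gamma> \<Delta> \<phi> assume a: "\<Gamma> \<subseteq> F" "\<forall>\<psi>\<in>\<Delta>. \<Gamma> \<turnstile>\<^bsub>\<Inter> ?S\<^esub> \<psi>" "\<Delta> \<turnstile>\<^bsub>\<Inter> ?S\<^esub> \<phi>"
    show "\<Gamma> \<turnstile>\<^bsub>\<Inter> ?S\<^esub> \<phi>"
    proof
      fix L' assume L': "L' \<in> ?S"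
      have 1: "\<forall>\<psi>\<in>\<Delta>. \<Gamma> \<turnstile>\<^bsub>L'\<^esub> \<psi>"
      proof
        fix \<psi> assume "\<psi> \<in> \<Delta>"
        with a(2) have "\<Gamma> \<turnstile>\<^bsub>\<Inter> ?S\<^esub> \<psi>" by (rule bspec)
        then show "\<Gamma> \<turnstile>\<^bsub>L'\<^esub> \<psi>" using L' by (rule InterD)
      qed
      have 2: "\<Delta> \<turnstile>\<^bsub>L'\<^esub> \<phi>" using a(3) L' by (rule InterD)
      show "\<Gamma> \<turnstile>\<^bsub>L'\<^esub> \<phi>" using S[OF L'] a(1) 1 2 by (rule logic_over_cut)
    qed
  next
    fix \<Gamma> \<phi> and \<sigma> :: "nat \<Rightarrow> fm" assume a: "range \<sigma> \<subseteq> F" "\<Gamma> \<turnstile>\<^bsub>\<Inter> ?S\<^esub> \<phi>"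
    show "(subst \<sigma> ` \<Gamma>) \<turnstile>\<^bsub>\<Inter> ?S\<^esub> (subst \<sigma> \<phi>)"
    proof
      fix L' assume L': "L' \<in> ?S"
      with a(2) have "\<Gamma> \<turnstile>\<^bsub>L'\<^esub> \<phi>" by (rule InterD)
      with S[OF L'] a(1) show "(subst \<sigma> ` \<Gamma>) \<turnstile>\<^bsub>L'\<^esub> (subst \<sigma> \<phi>)"
        by (rule logic_over_subst)
    qed
  qed
qed

lemma oplus_extends: "L \<subseteq> oplus F L X" and oplus_theorem: "\<phi> \<in> X \<Longrightarrow> {} \<turnstile>\<^bsub>oplus F L X\<^esub> \<phi>"
  unfolding oplus_def by auto

lemma oplus_least:
  "logic_over F L' \<Longrightarrow> L \<subseteq> L' \<Longrightarrow> (\<And>\<phi>. \<phi> \<in> X \<Longrightarrow> {} \<turnstile>\<^bsub>L'\<^esub> \<phi>) \<Longrightarrow> oplus F L X \<subseteq> L'"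
  unfolding oplus_def by auto

end

theory Submission
  imports Defs
begin

text \<open>
  The theorems \<open>(a \<rightarrow> b) + (b \<rightarrow> a)\<close>, which follow from \<open>0 \<rightarrow> 1\<close>, make a multiplicative theory
  linearly ordered as soon as it contains \<open>\<psi>\<close> or \<open>\<not>\<psi>\<close> for every \<open>\<psi>\<close>; minimum and maximum then turn
  its Lindenbaum algebra into a model of the logic with lattice connectives. So let \<open>T \<supseteq> \<Sigma>\<close> be maximal
  among the theories containing no nontrivial combination \<open>\<lambda>\<^sub>1\<phi>\<^sub>1 + \<dots> + \<lambda>\<^sub>n\<phi>\<^sub>n\<close>. If \<open>T\<close> omits both
  \<open>\<psi>\<close> and \<open>\<not>\<psi>\<close>, the deduction theorem yields such combinations \<open>s, t\<close> with \<open>\<psi>\<^sup>N \<rightarrow> s\<close> and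
  \<open>(\<not>\<psi>)\<^sup>N \<rightarrow> t\<close> in \<open>T\<close> for a common large \<open>N\<close>; the hypothesis \<open>(N\<psi>)\<^sup>k \<rightarrow> m(\<psi>\<^sup>N)\<close> then puts
  \<open>ms + kt\<close> into \<open>T\<close>, a contradiction. Hence \<open>T\<close> is complete and refutes
  \<open>\<phi>\<^sub>1 \<or> \<dots> \<or> \<phi>\<^sub>n\<close>. Conversely, for \<open>D = \<phi>\<^sub>1 \<or> \<dots> \<or> \<phi>\<^sub>n\<close> the formulas \<open>\<chi>\<close> with \<open>D \<or> \<chi>\<close> provable
  form a theory containing every \<open>\<not>\<phi>\<^sub>i\<close>, in which a nontrivial combination implies some \<open>\<phi>\<^sub>j\<close>.
\<close>

section \<open>Theories of multiplicative linear logic\<close>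

text \<open>The predicate abstracts from where a theory comes from. Later instances are derivability
  from a set, membership in a maximal set, consequence in a lattice logic, and provability of a
  disjunction with a fixed side formula.\<close>

locale mll =
  fixes P :: "fm \<Rightarrow> bool"
  assumes ax: "\<phi> \<in> ax_MLL UNIV \<Longrightarrow> P \<phi>"
    and mp: "P \<phi> \<Longrightarrow> P (\<phi> \<rightarrow> \<psi>) \<Longrightarrow> P \<psi>"
begin

lemma imp_refl: "P (a \<rightarrow> a)"
  by (rule ax) (simp add: ax_MLL.intros)

lemma imp_trans:
  assumes "P (a \<rightarrow> b)" "P (b \<rightarrow> c)"
  shows "P (a \<rightarrow> c)"
proof -
  have "P ((a \<rightarrow> b) \<rightarrow> ((b \<rightarrow> c) \<rightarrow> (a \<rightarrow> c)))" by (rule ax) (rule ax_MLL.intros; simp)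
  then show ?thesis using assms mp by blast
qed

lemma imp_exchange:
  assumes "P (a \<rightarrow> (b \<rightarrow> c))"
  shows "P (b \<rightarrow> (a \<rightarrow> c))"
proof -
  have "P ((a \<rightarrow> (b \<rightarrow> c)) \<rightarrow> (b \<rightarrow> (a \<rightarrow> c)))" by (rule ax) (rule ax_MLL.intros; simp)
  then show ?thesis using assms mp by blast
qed

lemma imp_antimono:
  assumes "P (a \<rightarrow> b)"
  shows "P ((b \<rightarrow> c) \<rightarrow> (a \<rightarrow> c))"
proof -
  have "P ((a \<rightarrow> b) \<rightarrow> ((b \<rightarrow> c) \<rightarrow> (a \<rightarrow> c)))" by (rule ax) (rule ax_MLL.intros; simp)
  then show ?thesis using assms mp by blast
qed

lemma imp_mono:
  assumes "P (b \<rightarrow> c)"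
  shows "P ((a \<rightarrow> b) \<rightarrow> (a \<rightarrow> c))"
proof -
  have "P ((a \<rightarrow> b) \<rightarrow> ((b \<rightarrow> c) \<rightarrow> (a \<rightarrow> c)))" by (rule ax) (rule ax_MLL.intros; simp)
  then show ?thesis using assms mp imp_exchange by blast
qed

lemma imp_mono':
  "P (x \<rightarrow> (a \<rightarrow> b)) \<Longrightarrow> P (a' \<rightarrow> a) \<Longrightarrow> P (b \<rightarrow> b') \<Longrightarrow> P (x \<rightarrow> (a' \<rightarrow> b'))"
  by (meson imp_trans imp_mono imp_antimono)

lemma one: "P \<one>"
  by (rule ax) (rule ax_MLL.intros)

lemma one_imp_iff: "P (\<one> \<rightarrow> a) \<longleftrightarrow> P a"
proof
  assume "P a"
  moreover have "P (a \<rightarrow> (\<one> \<rightarrow> a))" by (rule ax) (rule ax_MLL.intros; simp)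
  ultimately show "P (\<one> \<rightarrow> a)" using mp by blast
qed (use one mp in blast)

lemma imp_of_imp_one: "P (x \<rightarrow> \<one>) \<Longrightarrow> P a \<Longrightarrow> P (x \<rightarrow> a)"
  using imp_trans one_imp_iff by blast

lemma fus_intro: "P (a \<rightarrow> (b \<rightarrow> a \<odot> b))"
  by (rule ax) (rule ax_MLL.intros; simp)

lemma fus_imp_iff: "P (a \<odot> b \<rightarrow> c) \<longleftrightarrow> P (a \<rightarrow> (b \<rightarrow> c))"
proof
  assume "P (a \<rightarrow> (b \<rightarrow> c))"
  moreover have "P ((a \<rightarrow> (b \<rightarrow> c)) \<rightarrow> (a \<odot> b \<rightarrow> c))" by (rule ax) (rule ax_MLL.intros; simp)
  ultimately show "P (a \<odot> b \<rightarrow> c)" using mp by blast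
next
  assume "P (a \<odot> b \<rightarrow> c)"
  then show "P (a \<rightarrow> (b \<rightarrow> c))" using imp_trans[OF fus_intro imp_mono] by blast
qed

lemma fus_mono: "P (a \<rightarrow> a') \<Longrightarrow> P (b \<rightarrow> b') \<Longrightarrow> P (a \<odot> b \<rightarrow> a' \<odot> b')"
  by (meson fus_imp_iff fus_intro imp_trans imp_antimono)

lemma fus_assoc: "P ((a \<odot> b) \<odot> c \<rightarrow> a \<odot> (b \<odot> c))"
  unfolding fus_imp_iff
  by (meson fus_intro imp_exchange imp_mono' imp_refl imp_trans fus_imp_iff ax ax_MLL.intros UNIV_I)

section \<open>Negation, sums, multiples and powers\<close>

lemma neg_antimono: "P (a \<rightarrow> b) \<Longrightarrow> P (\<^bold>\<not> b \<rightarrow> \<^bold>\<not> a)"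
  by (simp add: Neg_def imp_antimono)

lemma neg_neg_elim: "P (\<^bold>\<not> \<^bold>\<not> a \<rightarrow> a)"
  by (rule ax) (rule ax_MLL.intros; simp)

lemma neg_neg_intro: "P (a \<rightarrow> \<^bold>\<not> \<^bold>\<not> a)"
  unfolding Neg_def by (rule imp_exchange) (rule imp_refl)

lemma neg_imp_swap: "P (\<^bold>\<not> a \<rightarrow> b) \<Longrightarrow> P (\<^bold>\<not> b \<rightarrow> a)"
  by (meson neg_antimono neg_neg_elim imp_trans)

lemma plus_iff: "P (a \<^bold>+ b) \<longleftrightarrow> P (\<^bold>\<not> a \<rightarrow> b)"
  by (simp add: Plus_def)

lemma plus_commute: "P (a \<^bold>+ b \<rightarrow> b \<^bold>+ a)"
proof -
  have "P ((\<^bold>\<not> a \<rightarrow> b) \<rightarrow> (\<^bold>\<not> b \<rightarrow> \<^bold>\<not> \<^bold>\<not> a))"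
    unfolding Neg_def by (rule ax) (rule ax_MLL.intros; simp)
  then show ?thesis
    unfolding Plus_def by (rule imp_mono'[OF _ imp_refl neg_neg_elim])
qed

lemma plus_mono: "P (a \<rightarrow> a') \<Longrightarrow> P (b \<rightarrow> b') \<Longrightarrow> P (a \<^bold>+ b \<rightarrow> a' \<^bold>+ b')"
  unfolding Plus_def by (rule imp_mono'[OF imp_refl neg_antimono])

text \<open>Fusing the negations of \<open>a\<close> and \<open>b\<close> gives the negation of
  their sum. Feeding this into the implication that defines the outer sum, and currying, rebrackets
  it.\<close>

lemma plus_assoc: "P ((a \<^bold>+ b) \<^bold>+ c \<rightarrow> a \<^bold>+ (b \<^bold>+ c))"
proof -
  have "P (\<^bold>\<not> a \<rightarrow> ((\<^bold>\<not> a \<rightarrow> b) \<rightarrow> b))" by (rule imp_exchange) (rule imp_refl)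
  moreover have "P (((\<^bold>\<not> a \<rightarrow> b) \<rightarrow> b) \<rightarrow> (\<^bold>\<not> b \<rightarrow> \<^bold>\<not> (\<^bold>\<not> a \<rightarrow> b)))"
    unfolding Neg_def by (rule ax) (rule ax_MLL.intros; simp)
  ultimately have "P (\<^bold>\<not> a \<rightarrow> (\<^bold>\<not> b \<rightarrow> \<^bold>\<not> (a \<^bold>+ b)))"
    unfolding Plus_def by (rule imp_trans)
  then have "P (\<^bold>\<not> a \<odot> \<^bold>\<not> b \<rightarrow> \<^bold>\<not> (a \<^bold>+ b))" by (simp add: fus_imp_iff)
  then have "P ((\<^bold>\<not> (a \<^bold>+ b) \<rightarrow> c) \<rightarrow> (\<^bold>\<not> a \<odot> \<^bold>\<not> b \<rightarrow> c))" by (rule imp_antimono)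
  then have "P (\<^bold>\<not> a \<odot> \<^bold>\<not> b \<rightarrow> ((\<^bold>\<not> (a \<^bold>+ b) \<rightarrow> c) \<rightarrow> c))" by (rule imp_exchange)
  then have "P (\<^bold>\<not> a \<rightarrow> (\<^bold>\<not> b \<rightarrow> ((\<^bold>\<not> (a \<^bold>+ b) \<rightarrow> c) \<rightarrow> c)))" by (simp add: fus_imp_iff)
  moreover have "P ((\<^bold>\<not> b \<rightarrow> ((\<^bold>\<not> (a \<^bold>+ b) \<rightarrow> c) \<rightarrow> c)) \<rightarrow> ((\<^bold>\<not> (a \<^bold>+ b) \<rightarrow> c) \<rightarrow> (\<^bold>\<not> b \<rightarrow> c)))"
    by (rule ax) (rule ax_MLL.intros; simp)
  ultimately have "P (\<^bold>\<not> a \<rightarrow> ((\<^bold>\<not> (a \<^bold>+ b) \<rightarrow> c) \<rightarrow> (\<^bold>\<not> b \<rightarrow> c)))" by (rule imp_trans)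
  then show ?thesis unfolding Plus_def[of _ c] Plus_def[of a "\<^bold>\<not> b \<rightarrow> c"]
    by (rule imp_exchange)
qed

lemma plus_assoc': "P (a \<^bold>+ (b \<^bold>+ c) \<rightarrow> (a \<^bold>+ b) \<^bold>+ c)"
  by (meson plus_assoc plus_commute plus_mono imp_refl imp_trans)

lemma plus_zero: "P (a \<^bold>+ \<zero> \<rightarrow> a)"
  using neg_neg_elim by (simp add: Plus_def Neg_def)

lemma plus_zero': "P (a \<rightarrow> a \<^bold>+ \<zero>)"
  using neg_neg_intro by (simp add: Plus_def Neg_def)

lemma zero_plus: "P (\<zero> \<^bold>+ a \<rightarrow> a)"
  using plus_commute plus_zero imp_trans by blast

lemma zero_plus': "P (a \<rightarrow> \<zero> \<^bold>+ a)"
  using plus_commute plus_zero' imp_trans by blast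

lemma plus_exchange: "P ((a \<^bold>+ b) \<^bold>+ (c \<^bold>+ d) \<rightarrow> (a \<^bold>+ c) \<^bold>+ (b \<^bold>+ d))"
proof -
  have "P (b \<^bold>+ (c \<^bold>+ d) \<rightarrow> c \<^bold>+ (b \<^bold>+ d))"
    by (meson plus_assoc plus_assoc' plus_commute plus_mono imp_refl imp_trans)
  then show ?thesis by (meson plus_assoc plus_assoc' plus_mono imp_refl imp_trans)
qed

lemma mult_mono: "P (a \<rightarrow> b) \<Longrightarrow> P (mult n a \<rightarrow> mult n b)"
  by (induction n) (simp_all add: imp_refl plus_mono)

lemma mult_add: "P (mult m a \<^bold>+ mult n a \<rightarrow> mult (m + n) a)"
proof (induction n)
  case 0
  then show ?case by (simp add: plus_zero)
next
  case (Suc n)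
  then show ?case using imp_trans[OF plus_assoc' plus_mono[OF Suc imp_refl]] by simp
qed

text \<open>A De Morgan law: contraposing an implication out of a power of a negation thus yields a
  multiple.\<close>

lemma neg_pow_neg: "P (\<^bold>\<not> (pow (\<^bold>\<not> a) n) \<rightarrow> mult n a)"
proof (induction n)
  case 0
  have "P ((\<one> \<rightarrow> \<zero>) \<rightarrow> \<zero>)" using imp_exchange imp_refl mp one by blast
  then show ?case by (simp add: Neg_def)
next
  case (Suc n)
  let ?x = "pow (\<^bold>\<not> a) n"
  have "P (\<^bold>\<not> (?x \<odot> \<^bold>\<not> a) \<rightarrow> (?x \<rightarrow> \<^bold>\<not> \<^bold>\<not> a))"
  proof -
    have "P (?x \<rightarrow> (\<^bold>\<not> a \<rightarrow> (\<^bold>\<not> (?x \<odot> \<^bold>\<not> a) \<rightarrow> \<zero>)))"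
      using neg_neg_intro[of "?x \<odot> \<^bold>\<not> a"] by (simp add: fus_imp_iff Neg_def)
    moreover have "P ((\<^bold>\<not> a \<rightarrow> (\<^bold>\<not> (?x \<odot> \<^bold>\<not> a) \<rightarrow> \<zero>)) \<rightarrow> (\<^bold>\<not> (?x \<odot> \<^bold>\<not> a) \<rightarrow> (\<^bold>\<not> a \<rightarrow> \<zero>)))"
      by (rule ax) (rule ax_MLL.intros; simp)
    ultimately have "P (?x \<rightarrow> (\<^bold>\<not> (?x \<odot> \<^bold>\<not> a) \<rightarrow> \<^bold>\<not> \<^bold>\<not> a))"
      unfolding Neg_def[of "\<^bold>\<not> a"] by (rule imp_trans)
    then show ?thesis by (rule imp_exchange)
  qed
  then show ?case
    using imp_mono'[OF _ neg_imp_swap[OF Suc] neg_neg_elim] by (simp add: Plus_def)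
qed

lemma pow_mono: "P (a \<rightarrow> b) \<Longrightarrow> P (pow a n \<rightarrow> pow b n)"
  by (induction n) (simp_all add: imp_refl fus_mono)

lemma imp_fus_one: "P (a \<rightarrow> a \<odot> \<one>)"
  using fus_intro imp_exchange mp one by blast

lemma pow_add: "P (pow a (m + n) \<rightarrow> pow a m \<odot> pow a n)"
proof (induction n)
  case 0
  then show ?case by (simp add: imp_fus_one)
next
  case (Suc n)
  then show ?case using imp_trans[OF fus_mono[OF Suc imp_refl] fus_assoc] by simp
qed

lemma pow_mult: "P (pow a (m * n) \<rightarrow> pow (pow a m) n)"
proof (induction n)
  case 0
  then show ?case by (simp add: imp_refl)
next
  case (Suc n)
  have "P (pow a (m * n + m) \<rightarrow> pow a (m * n) \<odot> pow a m)" by (rule pow_add)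
  then show ?case using imp_trans fus_mono[OF Suc imp_refl] by (simp add: add.commute)
qed

section \<open>Linear combinations with natural coefficients\<close>

lemma foldl_imp_foldr: "P (foldl Plus a xs \<rightarrow> a \<^bold>+ foldr Plus xs \<zero>)"
proof (induction xs arbitrary: a)
  case Nil
  then show ?case by (simp add: plus_zero')
next
  case (Cons x xs)
  then show ?case using imp_trans[OF _ plus_assoc] by simp
qed

lemma foldr_imp_foldl: "P (a \<^bold>+ foldr Plus xs \<zero> \<rightarrow> foldl Plus a xs)"
proof (induction xs arbitrary: a)
  case Nil
  then show ?case by (simp add: plus_zero)
next
  case (Cons x xs)
  then show ?case using imp_trans[OF plus_assoc'] by simp
qed

end

text \<open>Bracketed to the right with a trailing \<open>\<zero>\<close>, so that the empty
  combination is the unit of the sum and inductions peel off the head. \<open>Plus_list\<close> is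
  bracketed to the left; the two fold lemmas above connect the bracketings.\<close>

definition lincomb :: "nat list \<Rightarrow> fm list \<Rightarrow> fm" where
  "lincomb ls \<phi>s = foldr Plus (map2 mult ls \<phi>s) \<zero>"

lemma lincomb_Nil [simp]: "lincomb ls [] = \<zero>"
  by (simp add: lincomb_def)

lemma lincomb_Cons [simp]: "lincomb (l # ls) (\<phi> # \<phi>s) = mult l \<phi> \<^bold>+ lincomb ls \<phi>s"
  by (simp add: lincomb_def)

context mll
begin

lemma Plus_list_iff_lincomb:
  assumes "length ls = length \<phi>s" "\<phi>s \<noteq> []"
  shows "P (Plus_list (map2 mult ls \<phi>s)) \<longleftrightarrow> P (lincomb ls \<phi>s)"
proof -
  obtain l ls' \<phi> \<phi>s' where "ls = l # ls'" "\<phi>s = \<phi> # \<phi>s'"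
    using assms by (metis length_0_conv neq_Nil_conv)
  then show ?thesis
    using mp[OF _ foldl_imp_foldr] mp[OF _ foldr_imp_foldl]
    by (auto simp: Plus_list_def lincomb_def)
qed

lemma lincomb_add:
  assumes "length ls = length \<phi>s" "length ls' = length \<phi>s"
  shows "P (lincomb ls \<phi>s \<^bold>+ lincomb ls' \<phi>s \<rightarrow> lincomb (map2 (+) ls ls') \<phi>s)"
  using assms
proof (induction \<phi>s arbitrary: ls ls')
  case Nil
  then show ?case by (simp add: plus_zero)
next
  case (Cons \<phi> \<phi>s)
  obtain l ks l' ks' where ls: "ls = l # ks" "ls' = l' # ks'"
    using Cons.prems by (metis length_Suc_conv length_Cons)
  then have "P (lincomb ks \<phi>s \<^bold>+ lincomb ks' \<phi>s \<rightarrow> lincomb (map2 (+) ks ks') \<phi>s)"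
    using Cons by simp
  then show ?case using imp_trans[OF plus_exchange plus_mono[OF mult_add]] ls by simp
qed

lemma zero_imp_lincomb: "P (\<zero> \<rightarrow> lincomb (replicate (length \<phi>s) 0) \<phi>s)"
proof (induction \<phi>s)
  case Nil
  then show ?case by (simp add: imp_refl)
next
  case (Cons \<phi> \<phi>s)
  then show ?case using imp_trans[OF Cons zero_plus'] by simp
qed

lemma member_imp_lincomb:
  assumes "\<phi> \<in> set \<phi>s"
  shows "\<exists>ls. length ls = length \<phi>s \<and> (\<exists>l\<in>set ls. l \<noteq> 0) \<and> P (\<phi> \<rightarrow> lincomb ls \<phi>s)"
  using assms
proof (induction \<phi>s)
  case (Cons \<psi> \<phi>s)
  show ?case
  proof (cases "\<phi> = \<psi>")
    case True
    \<comment> \<open>The coefficients form a unit vector. Since \<open>mult 1 \<phi>\<close>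
      unfolds to \<open>\<zero>\<close> plus \<open>\<phi>\<close>, a zero is added on both
      sides.\<close>
    have "P (\<phi> \<rightarrow> mult 1 \<phi> \<^bold>+ lincomb (replicate (length \<phi>s) 0) \<phi>s)"
      using imp_trans[OF imp_trans[OF zero_plus' plus_zero'] plus_mono[OF imp_refl zero_imp_lincomb]]
      by simp
    then show ?thesis using True
      by (intro exI[of _ "1 # replicate (length \<phi>s) 0"]) simp
  next
    case False
    then obtain ls where ls: "length ls = length \<phi>s" "\<exists>l\<in>set ls. l \<noteq> 0" "P (\<phi> \<rightarrow> lincomb ls \<phi>s)"
      using Cons by auto
    then have "P (\<phi> \<rightarrow> mult 0 \<psi> \<^bold>+ lincomb ls \<phi>s)" using imp_trans[OF ls(3) zero_plus'] by simp
    then show ?thesis using ls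
      by (intro exI[of _ "0 # ls"]) auto
  qed
qed simp

lemma mult_imp_zero:
  assumes "P (\<phi> \<rightarrow> \<zero>)"
  shows "P (mult n \<phi> \<rightarrow> \<zero>)"
proof (induction n)
  case (Suc n)
  then show ?case using imp_trans[OF plus_mono[OF Suc assms] plus_zero] by simp
qed (simp add: imp_refl)

lemma mult_imp_self:
  assumes "P (\<phi> \<rightarrow> \<zero>)" "n \<noteq> 0"
  shows "P (mult n \<phi> \<rightarrow> \<phi>)"
proof -
  obtain m where "n = Suc m" using assms(2) not0_implies_Suc by blast
  then show ?thesis
    using imp_trans[OF plus_mono[OF mult_imp_zero[OF assms(1)] imp_refl] zero_plus] by simp
qed

lemma lincomb_imp_zero:
  assumes "length ls = length \<phi>s" "\<And>\<phi>. \<phi> \<in> set \<phi>s \<Longrightarrow> P (\<phi> \<rightarrow> \<zero>)"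
  shows "P (lincomb ls \<phi>s \<rightarrow> \<zero>)"
  using assms
proof (induction ls \<phi>s rule: list_induct2)
  case (Cons l ls \<phi> \<phi>s)
  then have "P (mult l \<phi> \<rightarrow> \<zero>)" "P (lincomb ls \<phi>s \<rightarrow> \<zero>)" by (simp_all add: mult_imp_zero)
  then show ?case using imp_trans[OF plus_mono plus_zero] by simp
qed (simp add: imp_refl)

text \<open>When all members lie below \<open>\<zero>\<close>, the unit of the sum, further summands
  only decrease it. So the sum lies below every member with a nonzero coefficient; the induction
  picks the first one.\<close>

lemma lincomb_imp_member:
  assumes "length ls = length \<phi>s" "\<And>\<phi>. \<phi> \<in> set \<phi>s \<Longrightarrow> P (\<phi> \<rightarrow> \<zero>)" "\<exists>l\<in>set ls. l \<noteq> 0"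
  shows "\<exists>\<phi>\<in>set \<phi>s. P (lincomb ls \<phi>s \<rightarrow> \<phi>)"
  using assms
proof (induction ls \<phi>s rule: list_induct2)
  case (Cons l ls \<phi> \<phi>s)
  have z: "P (\<phi> \<rightarrow> \<zero>)" "P (lincomb ls \<phi>s \<rightarrow> \<zero>)"
    using Cons by (auto intro: lincomb_imp_zero)
  show ?case
  proof (cases "l = 0")
    case True
    then obtain \<psi> where "\<psi> \<in> set \<phi>s" "P (lincomb ls \<phi>s \<rightarrow> \<psi>)" using Cons by auto
    then show ?thesis using True imp_trans[OF zero_plus] by auto
  next
    case False
    then show ?thesis
      using imp_trans[OF plus_mono[OF mult_imp_self[OF z(1)] z(2)] plus_zero] by auto
  qed
qed simp

end

section \<open>Consequences of \<open>\<zero> \<rightarrow> \<one>\<close>\<close>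

locale mll0 = mll +
  assumes zero_imp_one: "P (\<zero> \<rightarrow> \<one>)"
begin

lemma imp_neg_imp_one: "P (a \<rightarrow> (\<^bold>\<not> a \<rightarrow> \<one>))"
proof -
  have "P (a \<rightarrow> (\<^bold>\<not> a \<rightarrow> \<zero>))" using neg_neg_intro by (simp add: Neg_def)
  then show ?thesis using imp_mono' imp_refl zero_imp_one by blast
qed

text \<open>A formula fused with its negation implies \<open>\<zero>\<close>, hence
  \<open>\<one>\<close>, hence \<open>b \<rightarrow> b\<close>; exchanging premises turns this into
  the mix law.\<close>

lemma fus_imp_plus: "P (a \<odot> b \<rightarrow> a \<^bold>+ b)"
proof -
  have "P (\<one> \<rightarrow> (b \<rightarrow> b))" using one_imp_iff imp_refl by blast
  then have "P (a \<rightarrow> (\<^bold>\<not> a \<rightarrow> (b \<rightarrow> b)))" using imp_mono' imp_refl imp_neg_imp_one by blast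
  moreover have "P ((\<^bold>\<not> a \<rightarrow> (b \<rightarrow> b)) \<rightarrow> (b \<rightarrow> (\<^bold>\<not> a \<rightarrow> b)))" by (rule ax) (rule ax_MLL.intros; simp)
  ultimately show ?thesis unfolding fus_imp_iff Plus_def by (rule imp_trans)
qed

text \<open>Mix, applied factor by factor. For \<open>n = 0\<close> the claim would be
  \<open>\<one> \<rightarrow> \<zero>\<close>.\<close>

lemma pow_imp_mult:
  assumes "n \<noteq> 0"
  shows "P (pow a n \<rightarrow> mult n a)"
proof -
  have "P (pow a (Suc m) \<rightarrow> mult (Suc m) a)" for m
  proof (induction m)
    case 0
    have "P (\<one> \<odot> a \<rightarrow> a)" by (simp add: fus_imp_iff one_imp_iff imp_refl)
    then show ?case using imp_trans[OF _ zero_plus'] by simp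
  next
    case (Suc m)
    then show ?case
      using imp_trans[OF fus_imp_plus plus_mono[OF _ imp_refl]]
      by (subst pow.simps, subst mult.simps) blast
  qed
  then show ?thesis using assms not0_implies_Suc by blast
qed

text \<open>Mix turns the fusion of the negation of \<open>a\<close> with \<open>b\<close> into
  \<open>a \<rightarrow> b\<close>; residuation and commutativity of the sum rearrange this. It is a
  form of prelinearity with the sum in place of disjunction.\<close>

lemma imp_plus_imp: "P ((a \<rightarrow> b) \<^bold>+ (b \<rightarrow> a))"
proof -
  have "P (\<^bold>\<not> a \<odot> b \<rightarrow> (\<^bold>\<not> \<^bold>\<not> a \<rightarrow> b))" using fus_imp_plus by (simp add: Plus_def)
  then have "P (\<^bold>\<not> a \<odot> b \<rightarrow> (a \<rightarrow> b))" by (rule imp_mono'[OF _ neg_neg_intro imp_refl])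
  then have "P (b \<rightarrow> a \<^bold>+ (a \<rightarrow> b))" unfolding fus_imp_iff Plus_def by (rule imp_exchange)
  then have "P (b \<rightarrow> (\<^bold>\<not> (a \<rightarrow> b) \<rightarrow> a))"
    using imp_trans plus_commute unfolding Plus_def[of "a \<rightarrow> b", symmetric] by blast
  then show ?thesis unfolding Plus_def by (rule imp_exchange)
qed

end

section \<open>Disjunctions in theories of the logic with lattice connectives\<close>

locale iul_star = mll0 +
  assumes lattice_ax: "\<phi> \<in> ax_lattice UNIV \<Longrightarrow> P \<phi>"
    and adj: "P \<phi> \<Longrightarrow> P \<psi> \<Longrightarrow> P (\<phi> \<^bold>\<and> \<psi>)"
    and prelinear: "P (((\<phi> \<rightarrow> \<psi>) \<^bold>\<and> \<one>) \<^bold>\<or> ((\<psi> \<rightarrow> \<phi>) \<^bold>\<and> \<one>))"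
    and excluded_middle: "P (\<phi> \<^bold>\<or> \<^bold>\<not> \<phi>)"
begin

lemma conj_elims: "P (a \<^bold>\<and> b \<rightarrow> a)" "P (a \<^bold>\<and> b \<rightarrow> b)"
  by (simp_all add: lattice_ax ax_lattice.intros)

lemma disj_intros: "P (a \<rightarrow> a \<^bold>\<or> b)" "P (b \<rightarrow> a \<^bold>\<or> b)"
  by (simp_all add: lattice_ax ax_lattice.intros)

lemma imp_conj: "P (c \<rightarrow> a) \<Longrightarrow> P (c \<rightarrow> b) \<Longrightarrow> P (c \<rightarrow> a \<^bold>\<and> b)"
  by (meson adj mp lattice_ax ax_lattice.intros UNIV_I)

lemma disj_imp: "P (a \<rightarrow> c) \<Longrightarrow> P (b \<rightarrow> c) \<Longrightarrow> P (a \<^bold>\<or> b \<rightarrow> c)"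
  by (meson adj mp lattice_ax ax_lattice.intros UNIV_I)

lemma imp_disj_imp:
  assumes "P (c \<rightarrow> (a \<rightarrow> d))" "P (c \<rightarrow> (b \<rightarrow> d))"
  shows "P (c \<rightarrow> (a \<^bold>\<or> b \<rightarrow> d))"
  using assms disj_imp imp_exchange by blast

text \<open>Without weakening, a disjunct can be discarded as an extra premise only after it has
  been met with \<open>\<one>\<close>. Prelinearity compares \<open>a\<close> with \<open>b\<close>:
  in either case the given disjunction collapses to the larger of the two, and the comparison, being
  met with \<open>\<one>\<close>, supplies the bound.\<close>

lemma disj_cone:
  assumes "P (a \<^bold>\<or> b)"
  shows "P ((a \<^bold>\<and> \<one>) \<^bold>\<or> (b \<^bold>\<and> \<one>))"
proof -
  have triv: "P (((x \<rightarrow> y) \<^bold>\<and> \<one>) \<rightarrow> (z \<rightarrow> z))" for x y z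
    using imp_of_imp_one conj_elims imp_refl by blast
  have "P (((a \<rightarrow> b) \<^bold>\<and> \<one>) \<rightarrow> (a \<^bold>\<or> b \<rightarrow> b))"
    by (rule imp_disj_imp) (rule conj_elims triv)+
  then have "P (((a \<rightarrow> b) \<^bold>\<and> \<one>) \<rightarrow> b)" using assms imp_exchange mp by blast
  then have 1: "P (((a \<rightarrow> b) \<^bold>\<and> \<one>) \<rightarrow> (a \<^bold>\<and> \<one>) \<^bold>\<or> (b \<^bold>\<and> \<one>))"
    by (meson imp_conj conj_elims disj_intros imp_trans)
  have "P (((b \<rightarrow> a) \<^bold>\<and> \<one>) \<rightarrow> (a \<^bold>\<or> b \<rightarrow> a))"
    by (rule imp_disj_imp) (rule conj_elims triv)+
  then have "P (((b \<rightarrow> a) \<^bold>\<and> \<one>) \<rightarrow> a)" using assms imp_exchange mp by blast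
  then have "P (((b \<rightarrow> a) \<^bold>\<and> \<one>) \<rightarrow> (a \<^bold>\<and> \<one>) \<^bold>\<or> (b \<^bold>\<and> \<one>))"
    by (meson imp_conj conj_elims disj_intros imp_trans)
  with 1 show ?thesis using disj_imp mp prelinear by blast
qed

text \<open>Bring both disjunctions into the form of \<open>disj_cone\<close>. Of the four cases,
  those containing \<open>d\<close> drop the other premise because it implies \<open>\<one>\<close>;
  in the remaining one \<open>a\<close> meets \<open>a \<rightarrow> b\<close>.\<close>

lemma disj_mp:
  assumes "P (d \<^bold>\<or> a)" "P (d \<^bold>\<or> (a \<rightarrow> b))"
  shows "P (d \<^bold>\<or> b)"
proof -
  let ?d = "d \<^bold>\<and> \<one>" and ?x = "a \<^bold>\<and> \<one>" and ?y = "(a \<rightarrow> b) \<^bold>\<and> \<one>"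
  have dG: "P (?d \<rightarrow> d \<^bold>\<or> b)" using conj_elims disj_intros imp_trans by blast
  have neg: "P (c \<^bold>\<and> \<one> \<rightarrow> (?d \<rightarrow> d \<^bold>\<or> b))" for c
    using imp_of_imp_one conj_elims dG by blast
  have "P (?x \<rightarrow> (?y \<rightarrow> d \<^bold>\<or> b))"
    by (rule imp_exchange) (rule imp_mono'[OF conj_elims(1) conj_elims(1) disj_intros(2)])
  then have "P (?d \<^bold>\<or> ?x \<rightarrow> (?d \<^bold>\<or> ?y \<rightarrow> d \<^bold>\<or> b))"
    by (intro disj_imp imp_disj_imp neg) (rule imp_exchange[OF neg])
  then show ?thesis using disj_cone assms mp by blast
qed

text \<open>All results on theories with mix become available relative to the side disjunct
  \<open>d\<close>.\<close>

lemma mll0_disj: "mll0 (\<lambda>\<chi>. P (d \<^bold>\<or> \<chi>))"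
proof
  have weaken: "P \<chi> \<Longrightarrow> P (d \<^bold>\<or> \<chi>)" for \<chi> using disj_intros mp by blast
  show "P (d \<^bold>\<or> \<phi>)" if "\<phi> \<in> ax_MLL UNIV" for \<phi> using that ax weaken by blast
  show "P (d \<^bold>\<or> (\<zero> \<rightarrow> \<one>))" using zero_imp_one weaken by blast
qed (rule disj_mp)

lemma member_imp_Disj_list:
  assumes "\<phi> \<in> set \<phi>s"
  shows "P (\<phi> \<rightarrow> Disj_list \<phi>s)"
proof -
  have imp_foldl: "P (a \<rightarrow> foldl Disj a xs)" for a xs
  proof (induction xs arbitrary: a)
    case Nil
    then show ?case by (simp add: imp_refl)
  next
    case (Cons x xs)
    then show ?case using imp_trans[OF disj_intros(1) Cons] by simp
  qed
  have "\<phi> = a \<or> \<phi> \<in> set xs \<Longrightarrow> P (\<phi> \<rightarrow> foldl Disj a xs)" for a xs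
  proof (induction xs arbitrary: a)
    case Nil
    then show ?case by (simp add: imp_refl)
  next
    case (Cons x xs)
    then show ?case
      using imp_trans[OF disj_intros(1) imp_foldl] imp_trans[OF disj_intros(2) imp_foldl]
      by auto
  qed
  then show ?thesis using assms by (cases \<phi>s) (auto simp: Disj_list_def)
qed

text \<open>Relative to the side disjunct \<open>Disj_list \<phi>s\<close>, excluded middle puts
  every member below \<open>\<zero>\<close>. The combination then implies one of them, and the
  disjunction absorbs it.\<close>

lemma alternatives:
  assumes "length ls = length \<phi>s" "\<exists>l\<in>set ls. l \<noteq> 0" "P (Plus_list (map2 mult ls \<phi>s))"
  shows "P (Disj_list \<phi>s)"
proof -
  let ?d = "Disj_list \<phi>s"
  interpret Q: mll0 "\<lambda>\<chi>. P (?d \<^bold>\<or> \<chi>)" by (rule mll0_disj)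
  have ne: "\<phi>s \<noteq> []" using assms by auto
  have "P (?d \<^bold>\<or> (\<phi> \<rightarrow> \<zero>))" if "\<phi> \<in> set \<phi>s" for \<phi>
  proof -
    have "P (\<phi> \<^bold>\<or> \<^bold>\<not> \<phi> \<rightarrow> ?d \<^bold>\<or> \<^bold>\<not> \<phi>)"
      using member_imp_Disj_list[OF that] disj_imp disj_intros imp_trans by blast
    then show ?thesis using mp[OF excluded_middle] by (simp add: Neg_def)
  qed
  then obtain \<phi> where \<phi>: "\<phi> \<in> set \<phi>s" "P (?d \<^bold>\<or> (lincomb ls \<phi>s \<rightarrow> \<phi>))"
    using Q.lincomb_imp_member[OF assms(1) _ assms(2)] by blast
  have "P (lincomb ls \<phi>s)" using assms ne Plus_list_iff_lincomb by blast
  then have "P (?d \<^bold>\<or> lincomb ls \<phi>s)" using disj_intros mp by blast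
  then have "P (?d \<^bold>\<or> \<phi>)" using \<phi> Q.mp by blast
  moreover have "P (?d \<^bold>\<or> \<phi> \<rightarrow> ?d)" using disj_imp imp_refl member_imp_Disj_list \<phi>(1) by blast
  ultimately show ?thesis by (rule mp)
qed

end

section \<open>Complete theories interpret the lattice connectives\<close>

text \<open>In a complete theory \<open>P (\<phi> \<rightarrow> \<psi>)\<close> is a linear preorder, in which conjunction and disjunction
  are minimum and maximum. For \<open>P = (\<lambda>_. False)\<close> the map is just a retraction onto the
  multiplicative formulas.\<close>

primrec resolve :: "(fm \<Rightarrow> bool) \<Rightarrow> fm \<Rightarrow> fm" where
  "resolve P (Var x) = Var x"
| "resolve P (\<phi> \<rightarrow> \<psi>) = resolve P \<phi> \<rightarrow> resolve P \<psi>"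
| "resolve P (\<phi> \<odot> \<psi>) = resolve P \<phi> \<odot> resolve P \<psi>"
| "resolve P \<one> = \<one>"
| "resolve P \<zero> = \<zero>"
| "resolve P (\<phi> \<^bold>\<and> \<psi>) =
     (if P (resolve P \<phi> \<rightarrow> resolve P \<psi>) then resolve P \<phi> else resolve P \<psi>)"
| "resolve P (\<phi> \<^bold>\<or> \<psi>) =
     (if P (resolve P \<phi> \<rightarrow> resolve P \<psi>) then resolve P \<psi> else resolve P \<phi>)"

lemma resolve_Neg [simp]: "resolve P (\<^bold>\<not> \<phi>) = \<^bold>\<not> (resolve P \<phi>)"
  by (simp add: Neg_def)

lemma resolve_in_Fm_m: "resolve P \<phi> \<in> Fm_m"
  by (induction \<phi>) simp_all

text \<open>A multiplicative formula leaves nothing to decide, so only the substituted formulas are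
  resolved. Instances of multiplicative axioms therefore remain instances, now under a
  multiplicative substitution.\<close>

lemma resolve_subst:
  "\<phi> \<in> Fm_m \<Longrightarrow> resolve P (subst \<sigma> \<phi>) = subst (resolve P \<circ> \<sigma>) \<phi>"
  unfolding Fm_m_def by (induction \<phi>) simp_all

lemma resolve_Fm_m: "\<phi> \<in> Fm_m \<Longrightarrow> resolve P \<phi> = \<phi>"
  unfolding Fm_m_def by (induction \<phi>) simp_all

lemma resolve_ax_MLL: "\<phi> \<in> ax_MLL UNIV \<Longrightarrow> resolve P \<phi> \<in> ax_MLL Fm_m"
  by (erule ax_MLL.cases) (auto intro!: ax_MLL.intros simp: resolve_in_Fm_m)

text \<open>Each binary disjunction resolves to one of its arguments. Induction from the right
  follows the left bracketing.\<close>

lemma resolve_Disj_list: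
  assumes "\<phi>s \<noteq> []"
  shows "\<exists>\<phi>\<in>set \<phi>s. resolve P (Disj_list \<phi>s) = resolve P \<phi>"
proof -
  have "\<exists>\<phi>\<in>insert a (set xs). resolve P (foldl Disj a xs) = resolve P \<phi>" for a xs
  proof (induction xs rule: rev_induct)
    case (snoc x xs)
    then show ?case by auto
  qed simp
  then show ?thesis using assms by (cases \<phi>s) (auto simp: Disj_list_def)
qed

lemma ax_MLL_mono: "F \<subseteq> G \<Longrightarrow> ax_MLL F \<subseteq> ax_MLL G"
  by (auto elim!: ax_MLL.cases intro: ax_MLL.intros)

locale complete_theory = mll0 +
  assumes complete: "P \<phi> \<or> P (\<^bold>\<not> \<phi>)"
begin

text \<open>If the theory contains the negation of \<open>a \<rightarrow> b\<close>, then
  \<open>imp_plus_imp\<close>, read as an implication, yields the converse.\<close>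

lemma linear: "P (a \<rightarrow> b) \<or> P (b \<rightarrow> a)"
  using complete[of "a \<rightarrow> b"] imp_plus_imp[of a b] mp unfolding Plus_def by blast

lemma max_intro: "P x \<or> P y \<Longrightarrow> P (if P (x \<rightarrow> y) then y else x)"
  using mp[of x y] mp[of y x] linear[of x y] by auto

lemma resolve_ax: "\<phi> \<in> ax_MLL UNIV \<Longrightarrow> P (resolve P \<phi>)"
  using resolve_ax_MLL ax_MLL_mono[of Fm_m UNIV] ax by blast

lemma resolve_lattice_ax:
  assumes "\<phi> \<in> ax_lattice UNIV"
  shows "P (resolve P \<phi>)"
proof -
  have inf: "P ((if P (x \<rightarrow> y) then x else y) \<rightarrow> x)" "P ((if P (x \<rightarrow> y) then x else y) \<rightarrow> y)"
    and sup: "P (x \<rightarrow> (if P (x \<rightarrow> y) then y else x))" "P (y \<rightarrow> (if P (x \<rightarrow> y) then y else x))" for x y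
    using linear[of x y] by (auto simp: imp_refl)
  \<comment> \<open>Deciding \<open>y \<rightarrow> z\<close> fixes the minimum on the right, and
    the minimum on the left implies the matching implication by \<open>inf\<close>. The next fact
    treats a maximum in the antecedent in the same way.\<close>
  have imp_inf: "P ((if P ((x \<rightarrow> y) \<rightarrow> (x \<rightarrow> z)) then x \<rightarrow> y else x \<rightarrow> z) \<rightarrow>
      (x \<rightarrow> (if P (y \<rightarrow> z) then y else z)))" for x y z
    by (cases "P (y \<rightarrow> z)") (simp_all only: if_True if_False inf)
  have sup_imp: "P ((if P ((x \<rightarrow> z) \<rightarrow> (y \<rightarrow> z)) then x \<rightarrow> z else y \<rightarrow> z) \<rightarrow>
      ((if P (x \<rightarrow> y) then y else x) \<rightarrow> z))" for x y z
    by (cases "P (x \<rightarrow> y)") (simp_all only: if_True if_False inf)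
  show ?thesis using assms
    by cases (simp_all only: resolve.simps inf sup imp_inf sup_imp)
qed

end

section \<open>Extending theories to complete theories\<close>

context mll0
begin

text \<open>\<open>S\<close> stands for the nontrivial combinations. At a common exponent
  \<open>N\<close>, contraposing the second premise shows that the negation of \<open>t'\<close>
  implies \<open>mult N \<psi>\<close>. Its \<open>k\<close>-th power then implies
  \<open>mult m s'\<close>, and contraposing again gives the sum of \<open>mult m s'\<close> and
  \<open>mult k t'\<close>.\<close>

lemma eliminate_cases:
  fixes \<psi> :: fm
  assumes power_hyp: "\<And>n. n \<ge> n0 \<Longrightarrow> \<exists>m k. m \<ge> 1 \<and> P (pow (mult n \<psi>) k \<rightarrow> mult m (pow \<psi> n))"
    and plus: "\<And>s t. s \<in> S \<Longrightarrow> t \<in> S \<Longrightarrow> s \<^bold>+ t \<in> S"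
    and zero_plus_S: "\<And>s. s \<in> S \<Longrightarrow> \<zero> \<^bold>+ s \<in> S"
    and s: "s \<in> S" "P (pow \<psi> a \<rightarrow> s)"
    and t: "t \<in> S" "P (pow (\<^bold>\<not> \<psi>) b \<rightarrow> t)"
  shows "\<exists>u\<in>S. P u"
proof (cases "a = 0 \<or> b = 0")
  \<comment> \<open>A power with exponent 0 is \<open>\<one>\<close>, so \<open>s\<close> or
    \<open>t\<close> itself holds.\<close>
  case True
  then show ?thesis using s t by (auto simp: one_imp_iff)
next
  case False
  \<comment> \<open>Since \<open>mult 1 u\<close> is literally \<open>\<zero>\<close> plus
    \<open>u\<close>, the base case is closure under adding \<open>\<zero>\<close> on the
    left.\<close>
  have mult_S: "mult n u \<in> S" if "n \<noteq> 0" "u \<in> S" for n u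
  proof -
    have "mult (Suc i) u \<in> S" for i
      by (induction i) (simp_all add: that plus zero_plus_S)
    then show ?thesis using that(1) not0_implies_Suc by blast
  qed
  \<comment> \<open>Raise the implication to the \<open>j\<close>-th power, then replace the power
    of \<open>u\<close> by a multiple using mix.\<close>
  have scale: "P (pow x (c * j) \<rightarrow> mult j u)" if "j \<noteq> 0" "P (pow x c \<rightarrow> u)" for x u c j
    using imp_trans[OF pow_mult imp_trans[OF pow_mono[OF that(2)] pow_imp_mult[OF that(1)]]] .
  \<comment> \<open>A multiple of \<open>a\<close> and of \<open>b\<close>, so that both premises
    scale to it; the factor \<open>Suc n0\<close> brings it into the range of
    \<open>power_hyp\<close>.\<close>
  define N where "N = a * b * Suc n0"
  have N: "N = a * (b * Suc n0)" "N = b * (a * Suc n0)" by (simp_all add: N_def algebra_simps)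
  have "N \<ge> n0"
  proof -
    have "1 * Suc n0 \<le> N" unfolding N_def by (rule mult_le_mono1) (use False in simp)
    then show ?thesis by simp
  qed
  then obtain m k where mk: "m \<ge> 1" "P (pow (mult N \<psi>) k \<rightarrow> mult m (pow \<psi> N))"
    using power_hyp by blast
  define s' where "s' = mult (b * Suc n0) s"
  define t' where "t' = mult (a * Suc n0) t"
  have S: "s' \<in> S" "t' \<in> S"
    unfolding s'_def t'_def using False s t by (intro mult_S; simp)+
  have "P (pow \<psi> N \<rightarrow> s')"
    using scale[OF _ s(2), of "b * Suc n0"] False unfolding s'_def N(1) by simp
  then have 1: "P (pow (mult N \<psi>) k \<rightarrow> mult m s')" using imp_trans[OF mk(2) mult_mono] by blast
  have "P (pow (\<^bold>\<not> \<psi>) N \<rightarrow> t')"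
    using scale[OF _ t(2), of "a * Suc n0"] False unfolding t'_def N(2) by simp
  then have "P (\<^bold>\<not> t' \<rightarrow> mult N \<psi>)" using imp_trans[OF neg_antimono neg_pow_neg] by blast
  then have 2: "P (pow (\<^bold>\<not> t') k \<rightarrow> mult m s')" using imp_trans[OF pow_mono 1] by blast
  show ?thesis
  proof (cases "k = 0")
    \<comment> \<open>Here \<open>mult k t'\<close> would be \<open>\<zero>\<close>, which need not
      keep the sum in \<open>S\<close>. But the empty power is \<open>\<one>\<close>, so
      \<open>mult m s'\<close> holds by itself.\<close>
    case True
    then have "P (mult m s')" using 2 by (simp add: one_imp_iff)
    then show ?thesis using mult_S[OF _ S(1), of m] mk(1) by auto
  next
    case False
    have "P (mult m s' \<^bold>+ mult k t')"
      unfolding plus_iff using imp_trans[OF neg_antimono[OF 2] neg_pow_neg] .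
    moreover have "mult m s' \<^bold>+ mult k t' \<in> S"
      using plus[OF mult_S[OF _ S(1)] mult_S[OF _ S(2)]] mk(1) False by simp
    ultimately show ?thesis by blast
  qed
qed

end

section \<open>Derivability from instances of \<open>A\<close>, and maximal theories\<close>

text \<open>Instances are taken under all substitutions, also by lattice formulas, so that
  derivability lives on the whole type and modus ponens is its only rule. A retraction later
  restores multiplicative derivations.\<close>

definition mix_axioms :: "fm set \<Rightarrow> fm set" where
  "mix_axioms A = insert (\<zero> \<rightarrow> \<one>) (ax_MLL UNIV \<union> {subst \<sigma> \<alpha> |\<sigma> \<alpha>. \<alpha> \<in> A})"

abbreviation mix_derives :: "fm set \<Rightarrow> fm set \<Rightarrow> fm \<Rightarrow> bool" where
  "mix_derives A \<equiv> derives (mix_axioms A) (rule_MP UNIV)"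

lemma mix_derives_mp:
  assumes "mix_derives A \<Gamma> \<phi>" "mix_derives A \<Gamma> (\<phi> \<rightarrow> \<psi>)"
  shows "mix_derives A \<Gamma> \<psi>"
  by (rule derives.rule[of "{\<phi>, \<phi> \<rightarrow> \<psi>}"]) (use assms in \<open>auto simp: rule_MP_def\<close>)

lemma mll0_mix_derives: "mll0 (mix_derives A \<Gamma>)"
proof
  show "mix_derives A \<Gamma> \<phi>" if "\<phi> \<in> ax_MLL UNIV" for \<phi>
    using that by (auto intro: derives.axiom simp: mix_axioms_def)
  show "mix_derives A \<Gamma> (\<zero> \<rightarrow> \<one>)"
    by (auto intro: derives.axiom simp: mix_axioms_def)
qed (rule mix_derives_mp)

lemma derives_mono: "derives Ax R \<Gamma> \<phi> \<Longrightarrow> \<Gamma> \<subseteq> \<Delta> \<Longrightarrow> derives Ax R \<Delta> \<phi>"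
  by (erule derives_cut) (auto intro: derives.hypothesis)

lemma mix_derives_induct [consumes 1, case_names hypothesis axiom mp]:
  assumes "mix_derives A \<Gamma> \<phi>"
    and "\<And>\<phi>. \<phi> \<in> \<Gamma> \<Longrightarrow> Q \<phi>"
    and "\<And>\<phi>. \<phi> \<in> mix_axioms A \<Longrightarrow> Q \<phi>"
    and "\<And>\<phi> \<psi>. Q \<phi> \<Longrightarrow> Q (\<phi> \<rightarrow> \<psi>) \<Longrightarrow> Q \<psi>"
  shows "Q \<phi>"
  using assms(1)
proof induction
  case (rule \<Delta> \<phi>)
  then obtain \<psi> where "\<Delta> = {\<psi>, \<psi> \<rightarrow> \<phi>}" by (auto simp: rule_MP_def)
  then show ?case using rule.IH assms(4) by blast
qed (use assms in auto)

text \<open>A local deduction theorem: without contraction every use of \<open>\<psi>\<close>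
  counts, so exponents add at modus ponens. Axioms and members of \<open>\<Gamma>\<close> other than
  \<open>\<psi>\<close> get exponent 0.\<close>

lemma deduction:
  assumes "mix_derives A (insert \<psi> \<Gamma>) \<chi>"
  shows "\<exists>n. mix_derives A \<Gamma> (pow \<psi> n \<rightarrow> \<chi>)"
proof -
  interpret mll0 "mix_derives A \<Gamma>" by (rule mll0_mix_derives)
  have triv: "\<exists>n. mix_derives A \<Gamma> (pow \<psi> n \<rightarrow> \<chi>)" if "mix_derives A \<Gamma> \<chi>" for \<chi>
    using that by (intro exI[of _ 0]) (simp add: one_imp_iff)
  show ?thesis using assms
  proof (induction rule: mix_derives_induct)
    case (hypothesis \<chi>)
    show ?case
    proof (cases "\<chi> = \<psi>")
      case True
      have "mix_derives A \<Gamma> (pow \<psi> 1 \<rightarrow> \<psi>)" by (simp add: fus_imp_iff one_imp_iff imp_refl)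
      with True show ?thesis by blast
    qed (use hypothesis triv derives.hypothesis in blast)
  next
    case (axiom \<chi>)
    then show ?case using triv derives.axiom by blast
  next
    case (mp \<phi> \<chi>)
    then obtain m n where
      "mix_derives A \<Gamma> (pow \<psi> m \<rightarrow> \<phi>)" "mix_derives A \<Gamma> (pow \<psi> n \<rightarrow> (\<phi> \<rightarrow> \<chi>))" by blast
    then have "mix_derives A \<Gamma> (pow \<psi> n \<rightarrow> (pow \<psi> m \<rightarrow> \<chi>))"
      using imp_mono'[OF _ _ imp_refl] by blast
    then have "mix_derives A \<Gamma> (pow \<psi> (n + m) \<rightarrow> \<chi>)"
      unfolding fus_imp_iff[symmetric] by (rule imp_trans[OF pow_add])
    then show ?case by blast
  qed
qed

text \<open>Derivations are finitary: at modus ponens the premises come from two members of the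
  chain, and the larger serves both. Nonemptiness supplies a member for the axioms.\<close>

lemma mix_derives_chain:
  assumes "mix_derives A (\<Union>C) \<phi>" "C \<noteq> {}" "subset.chain \<A> C"
  shows "\<exists>T\<in>C. mix_derives A T \<phi>"
  using assms(1)
proof (induction rule: mix_derives_induct)
  case (hypothesis \<phi>)
  then show ?case by (blast intro: derives.hypothesis)
next
  case (axiom \<phi>)
  then show ?case using assms(2) by (blast intro: derives.axiom)
next
  case (mp \<phi> \<psi>)
  then obtain T U where T: "T \<in> C" "mix_derives A T \<phi>" and U: "U \<in> C" "mix_derives A U (\<phi> \<rightarrow> \<psi>)"
    by blast
  have "T \<union> U \<in> C"
  proof -
    have "T \<subseteq> U \<or> U \<subseteq> T" using assms(3) T(1) U(1) unfolding subset_chain_def by blast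
    then show ?thesis using T(1) U(1) by (auto simp: sup.absorb1 sup.absorb2)
  qed
  moreover have "mix_derives A (T \<union> U) \<psi>"
    by (rule mix_derives_mp[OF derives_mono[OF T(2)] derives_mono[OF U(2)]]) auto
  ultimately show ?case by blast
qed

text \<open>Zorn's lemma gives a maximal \<open>T\<close>. A formula outside \<open>T\<close>
  derives, together with \<open>T\<close>, some member of \<open>S\<close>. Hence \<open>T\<close>
  is deductively closed by cut, and complete by \<open>eliminate_cases\<close> for
  \<open>\<psi>\<close> and its negation.\<close>

lemma complete_extension:
  assumes power_hyp: "\<And>n \<psi>. n \<ge> n0 \<Longrightarrow>
      \<exists>m k. m \<ge> 1 \<and> mix_derives A {} (pow (mult n \<psi>) k \<rightarrow> mult m (pow \<psi> n))"
    and plus: "\<And>s t. s \<in> S \<Longrightarrow> t \<in> S \<Longrightarrow> s \<^bold>+ t \<in> S"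
    and zero_plus_S: "\<And>s. s \<in> S \<Longrightarrow> \<zero> \<^bold>+ s \<in> S"
    and avoid: "\<And>s. s \<in> S \<Longrightarrow> \<not> mix_derives A \<Gamma> s"
  obtains T where "\<Gamma> \<subseteq> T" "T \<inter> S = {}" "mix_axioms A \<subseteq> T" "complete_theory (\<lambda>\<phi>. \<phi> \<in> T)"
proof -
  \<comment> \<open>Derivability of members of \<open>S\<close> is excluded, not just membership, so
    these sets need not be closed; closure comes from maximality.\<close>
  define \<A> where "\<A> = {T. \<Gamma> \<subseteq> T \<and> (\<forall>s\<in>S. \<not> mix_derives A T s)}"
  have "\<exists>T\<in>\<A>. \<forall>X\<in>\<A>. T \<subseteq> X \<longrightarrow> X = T"
  proof (rule subset_Zorn_nonempty)
    show "\<A> \<noteq> {}" using avoid by (auto simp: \<A>_def)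
    fix C assume C: "C \<noteq> {}" "subset.chain \<A> C"
    then have "C \<subseteq> \<A>" by (simp add: subset.chain_def)
    then show "\<Union>C \<in> \<A>" using C mix_derives_chain[OF _ C] unfolding \<A>_def by blast
  qed
  then obtain T where T: "T \<in> \<A>" and max: "\<And>X. X \<in> \<A> \<Longrightarrow> T \<subseteq> X \<Longrightarrow> X = T" by blast
  have extend: "\<exists>s\<in>S. mix_derives A (insert \<psi> T) s" if "\<psi> \<notin> T" for \<psi>
  proof (rule ccontr)
    assume "\<not> ?thesis"
    then have "insert \<psi> T \<in> \<A>" using T by (auto simp: \<A>_def)
    then show False using max[of "insert \<psi> T"] that by blast
  qed
  have closed: "\<phi> \<in> T" if \<phi>: "mix_derives A T \<phi>" for \<phi>
  proof (rule ccontr)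
    assume "\<phi> \<notin> T"
    then obtain s where s: "s \<in> S" "mix_derives A (insert \<phi> T) s" using extend by blast
    have "mix_derives A T s"
      using derives_cut[OF s(2)] \<phi> by (auto intro: derives.hypothesis)
    then show False using s(1) T by (auto simp: \<A>_def)
  qed
  interpret mll0 "mix_derives A T" by (rule mll0_mix_derives)
  have "mll0 (\<lambda>\<phi>. \<phi> \<in> T)"
  proof
    show "\<psi> \<in> T" if "\<phi> \<in> T" "\<phi> \<rightarrow> \<psi> \<in> T" for \<phi> \<psi>
      using that closed mix_derives_mp derives.hypothesis by metis
  qed (use ax zero_imp_one closed in blast)+
  moreover have "\<psi> \<in> T \<or> \<^bold>\<not> \<psi> \<in> T" for \<psi>
  proof (rule ccontr)
    assume "\<not> ?thesis"
    then obtain s t where st: "s \<in> S" "mix_derives A (insert \<psi> T) s"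
        "t \<in> S" "mix_derives A (insert (\<^bold>\<not> \<psi>) T) t"
      using extend by meson
    then obtain a b where
      ab: "mix_derives A T (pow \<psi> a \<rightarrow> s)" "mix_derives A T (pow (\<^bold>\<not> \<psi>) b \<rightarrow> t)"
      using deduction by meson
    have "\<exists>m k. m \<ge> 1 \<and> mix_derives A T (pow (mult n \<psi>) k \<rightarrow> mult m (pow \<psi> n))"
      if "n \<ge> n0" for n
      using power_hyp[OF that] derives_mono by blast
    then have "\<exists>u\<in>S. mix_derives A T u"
      using eliminate_cases[OF _ plus zero_plus_S st(1) ab(1) st(3) ab(2)] by blast
    then show False using T by (auto simp: \<A>_def)
  qed
  ultimately have "complete_theory (\<lambda>\<phi>. \<phi> \<in> T)"
    by (simp add: complete_theory_def complete_theory_axioms_def)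
  moreover have "\<Gamma> \<subseteq> T" "T \<inter> S = {}" using T by (auto simp: \<A>_def intro: derives.hypothesis)
  moreover have "mix_axioms A \<subseteq> T" using closed derives.axiom by blast
  ultimately show thesis using that by blast
qed

section \<open>The theorem of alternatives\<close>

lemma subst_Var [simp]: "subst Var \<phi> = \<phi>"
  by (induction \<phi>) simp_all

lemma subst_subst: "subst \<sigma> (subst \<tau> \<phi>) = subst (subst \<sigma> \<circ> \<tau>) \<phi>"
  by (induction \<phi>) simp_all

lemma mix_derives_subst:
  assumes "mix_derives A \<Gamma> \<phi>"
  shows "mix_derives A (subst \<sigma> ` \<Gamma>) (subst \<sigma> \<phi>)"
  using assms
proof (rule derives_subst)
  show "subst \<sigma> \<phi> \<in> mix_axioms A" if "\<phi> \<in> mix_axioms A" for \<phi>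
    using that ax_MLL_subst[of UNIV \<sigma> \<phi>] by (auto simp: mix_axioms_def subst_subst)
qed (rule rule_subst(1), simp_all)

text \<open>Derivability restricted to multiplicative formulas is a logic containing
  \<open>MLL\<close>, \<open>\<zero> \<rightarrow> \<one>\<close> and \<open>A\<close>, hence
  contains the least one.\<close>

lemma oplus_MLL0_mix_derives:
  assumes "A \<subseteq> Fm_m" "\<Gamma> \<turnstile>\<^bsub>oplus Fm_m MLL0 A\<^esub> \<phi>"
  shows "mix_derives A \<Gamma> \<phi>"
proof -
  let ?L = "{(\<Gamma>, \<phi>). \<Gamma> \<subseteq> Fm_m \<and> \<phi> \<in> Fm_m \<and> mix_derives A \<Gamma> \<phi>}"
  have logic: "logic_over Fm_m ?L"
    unfolding logic_over_def
  proof (intro conjI allI impI)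
    fix \<Gamma> \<Delta> \<phi>
    assume a: "\<Gamma> \<subseteq> Fm_m" "\<forall>\<psi>\<in>\<Delta>. \<Gamma> \<turnstile>\<^bsub>?L\<^esub> \<psi>" "\<Delta> \<turnstile>\<^bsub>?L\<^esub> \<phi>"
    then have "mix_derives A \<Delta> \<phi>" "\<And>\<psi>. \<psi> \<in> \<Delta> \<Longrightarrow> mix_derives A \<Gamma> \<psi>" by auto
    then have "mix_derives A \<Gamma> \<phi>" by (rule derives_cut)
    then show "\<Gamma> \<turnstile>\<^bsub>?L\<^esub> \<phi>" using a by simp
  next
    fix \<Gamma> \<phi> and \<sigma> :: "nat \<Rightarrow> fm"
    assume "range \<sigma> \<subseteq> Fm_m" "\<Gamma> \<turnstile>\<^bsub>?L\<^esub> \<phi>"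
    then show "(subst \<sigma> ` \<Gamma>) \<turnstile>\<^bsub>?L\<^esub> (subst \<sigma> \<phi>)"
      using mix_derives_subst[of A \<Gamma> \<phi> \<sigma>] subst_Fm_m[of \<sigma>] by auto
  qed (auto intro: derives.hypothesis derives_mono)
  have "MLL \<subseteq> ?L"
  proof
    fix x assume "x \<in> MLL"
    then obtain \<Gamma> \<phi> where x: "x = (\<Gamma>, \<phi>)" "\<Gamma> \<turnstile>\<^bsub>MLL\<^esub> \<phi>" by (cases x) auto
    then have "\<Gamma> \<subseteq> Fm_m" "\<phi> \<in> Fm_m" using logic_over_MLL by (auto simp: logic_over_def)
    moreover have "derives (ax_MLL Fm_m) (rule_MP Fm_m) \<Gamma> \<phi>" using x by (simp add: MLL_def axiomatized_def)
    then have "mix_derives A \<Gamma> \<phi>"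
    proof induction
      case (axiom \<phi>)
      then have "\<phi> \<in> mix_axioms A" using ax_MLL_mono[of Fm_m UNIV] by (auto simp: mix_axioms_def)
      then show ?case by (rule derives.axiom)
    next
      case (rule \<Delta> \<phi>)
      show ?case by (rule derives.rule[of \<Delta>]) (use rule in \<open>auto simp: rule_MP_def\<close>)
    qed (rule derives.hypothesis)
    ultimately show "x \<in> ?L" using x by simp
  qed
  moreover have "{} \<turnstile>\<^bsub>?L\<^esub> (\<zero> \<rightarrow> \<one>)" using mll0.zero_imp_one[OF mll0_mix_derives] by simp
  ultimately have "MLL0 \<subseteq> ?L" unfolding MLL0_def by (intro oplus_least logic) auto
  moreover have "{} \<turnstile>\<^bsub>?L\<^esub> \<alpha>" if "\<alpha> \<in> A" for \<alpha>
  proof -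
    \<comment> \<open>The identity substitution makes \<open>\<alpha>\<close> an instance of
      itself.\<close>
    have "subst Var \<alpha> \<in> mix_axioms A" using that unfolding mix_axioms_def by blast
    then show ?thesis using that assms(1) by (auto intro: derives.axiom)
  qed
  ultimately have "oplus Fm_m MLL0 A \<subseteq> ?L" by (intro oplus_least logic) auto
  then show ?thesis using assms(2) by auto
qed

lemma logic_over_oplus_MLL0u:
  assumes "A \<subseteq> Fm_m"
  shows "logic_over Fm_m (oplus Fm_m MLL0u A)"
proof -
  have "logic_over Fm_m MLL0u" unfolding MLL0u_def
    using logic_over_MLLu by (intro logic_over_oplus subst_Fm_m) (auto simp: logic_over_def)
  then show ?thesis
    using assms by (intro logic_over_oplus subst_Fm_m) (auto simp: logic_over_def)
qed

text \<open>A derivation may pass through lattice formulas. Applying the retraction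
  \<open>?r\<close> to each of its formulas makes it multiplicative and fixes hypotheses and
  conclusion.\<close>

lemma mix_derives_oplus_MLL0u:
  assumes A: "A \<subseteq> Fm_m" and \<Gamma>: "\<Gamma> \<subseteq> Fm_m" "\<phi> \<in> Fm_m" and "mix_derives A \<Gamma> \<phi>"
  shows "\<Gamma> \<turnstile>\<^bsub>oplus Fm_m MLL0u A\<^esub> \<phi>"
proof -
  let ?M = "oplus Fm_m MLL0u A" and ?r = "resolve (\<lambda>_. False)"
  have logic: "logic_over Fm_m ?M" by (rule logic_over_oplus_MLL0u[OF A])
  have sub: "MLLu \<subseteq> ?M" using oplus_extends unfolding MLL0u_def by blast
  have valid: "\<Gamma> \<turnstile>\<^bsub>?M\<^esub> \<phi>" if "{} \<turnstile>\<^bsub>?M\<^esub> \<phi>" for \<phi>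
    using logic_over_mono[OF logic that _ \<Gamma>(1)] by simp
  have "\<Gamma> \<turnstile>\<^bsub>?M\<^esub> (?r \<phi>)"
    using \<open>mix_derives A \<Gamma> \<phi>\<close>
  proof (induction rule: mix_derives_induct)
    case (hypothesis \<phi>)
    then have "?r \<phi> = \<phi>" using \<Gamma>(1) resolve_Fm_m by blast
    then show ?case using logic_over_refl[OF logic \<Gamma>(1) hypothesis] by simp
  next
    case (axiom \<phi>)
    then consider "\<phi> \<in> ax_MLL UNIV" | "\<phi> = \<zero> \<rightarrow> \<one>" | \<sigma> \<alpha> where "\<alpha> \<in> A" "\<phi> = subst \<sigma> \<alpha>"
      by (auto simp: mix_axioms_def)
    then have "{} \<turnstile>\<^bsub>?M\<^esub> (?r \<phi>)"
    proof cases
      case 1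
      then have "{} \<turnstile>\<^bsub>MLLu\<^esub> (?r \<phi>)"
        by (auto simp: MLLu_def axiomatized_def intro: derives.axiom resolve_ax_MLL)
      then show ?thesis using sub by blast
    next
      case 2
      have "{} \<turnstile>\<^bsub>MLL0u\<^esub> (\<zero> \<rightarrow> \<one>)" unfolding MLL0u_def by (rule oplus_theorem) simp
      then show ?thesis using 2 oplus_extends by auto
    next
      case 3
      have "range (?r \<circ> \<sigma>) \<subseteq> Fm_m" using resolve_in_Fm_m by auto
      from logic_over_subst[OF logic this oplus_theorem[OF 3(1)]]
      show ?thesis using 3 A resolve_subst by auto
    qed
    then show ?case by (rule valid)
  next
    case (mp \<phi> \<psi>)
    have "({?r \<phi>, ?r \<phi> \<rightarrow> ?r \<psi>}, ?r \<psi>) \<in> rule_MP Fm_m \<union> rule_u Fm_m"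
      using resolve_in_Fm_m by (auto simp: rule_MP_def)
    then have "derives (ax_MLL Fm_m) (rule_MP Fm_m \<union> rule_u Fm_m) {?r \<phi>, ?r \<phi> \<rightarrow> ?r \<psi>} (?r \<psi>)"
      by (rule derives.rule) (rule derives.hypothesis)
    then have "{?r \<phi>, ?r \<phi> \<rightarrow> ?r \<psi>} \<turnstile>\<^bsub>MLLu\<^esub> (?r \<psi>)"
      by (simp add: MLLu_def axiomatized_def resolve_in_Fm_m)
    then have "{?r \<phi>, ?r \<phi> \<rightarrow> ?r \<psi>} \<turnstile>\<^bsub>?M\<^esub> (?r \<psi>)" using sub by blast
    then show ?case by (rule logic_over_cut[OF logic \<Gamma>(1), rotated]) (use mp in simp)
  qed
  then show ?thesis using \<Gamma>(2) resolve_Fm_m by simp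
qed

section \<open>Consequence over complete theories\<close>

text \<open>Consequence over linearly ordered models: a complete theory \<open>P\<close> containing
  the axioms is a model whose designated elements are the members of \<open>P\<close>, and
  \<open>\<sigma>\<close> followed by \<open>resolve P\<close> is a valuation. Quantifying over
  \<open>\<sigma>\<close> builds in substitution invariance.\<close>

definition chain_consequence :: "fm set \<Rightarrow> crel" where
  "chain_consequence A = {(\<Gamma>, \<phi>). \<forall>P \<sigma>. complete_theory P \<longrightarrow> (\<forall>\<alpha>\<in>mix_axioms A. P \<alpha>) \<longrightarrow>
     (\<forall>\<gamma>\<in>\<Gamma>. P (resolve P (subst \<sigma> \<gamma>))) \<longrightarrow> P (resolve P (subst \<sigma> \<phi>))}"

lemma logic_over_chain_consequence: "logic_over Fm_l (chain_consequence A)"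
  unfolding logic_over_def
proof (intro conjI allI impI)
  fix \<Gamma> \<phi> and \<sigma> :: "nat \<Rightarrow> fm"
  assume "\<Gamma> \<turnstile>\<^bsub>chain_consequence A\<^esub> \<phi>"
  then show "(subst \<sigma> ` \<Gamma>) \<turnstile>\<^bsub>chain_consequence A\<^esub> (subst \<sigma> \<phi>)"
    unfolding chain_consequence_def by (simp add: subst_subst) blast
next
  fix \<Gamma> \<Delta> \<phi>
  assume "\<forall>\<psi>\<in>\<Delta>. \<Gamma> \<turnstile>\<^bsub>chain_consequence A\<^esub> \<psi>" "\<Delta> \<turnstile>\<^bsub>chain_consequence A\<^esub> \<phi>"
  then show "\<Gamma> \<turnstile>\<^bsub>chain_consequence A\<^esub> \<phi>"
    unfolding chain_consequence_def by simp blast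
next
  fix \<Gamma> \<Delta> \<phi>
  assume "\<Gamma> \<turnstile>\<^bsub>chain_consequence A\<^esub> \<phi>" "\<Gamma> \<subseteq> \<Delta>"
  then show "\<Delta> \<turnstile>\<^bsub>chain_consequence A\<^esub> \<phi>"
    unfolding chain_consequence_def by simp blast
qed (simp_all add: Fm_l_def chain_consequence_def)

lemma MALLminus_chain_consequence: "MALLminus \<subseteq> chain_consequence A"
proof clarify
  fix \<Gamma> \<phi>
  assume "\<Gamma> \<turnstile>\<^bsub>MALLminus\<^esub> \<phi>"
  then have der: "derives (ax_MLL UNIV \<union> ax_lattice UNIV) (rule_MP UNIV \<union> rule_adj UNIV) \<Gamma> \<phi>"
    by (simp add: MALLminus_def axiomatized_def Fm_l_def)
  have "P (resolve P (subst \<sigma> \<phi>))"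
    if P: "complete_theory P" and \<Gamma>: "\<forall>\<gamma>\<in>\<Gamma>. P (resolve P (subst \<sigma> \<gamma>))" for P \<sigma>
  proof -
    interpret complete_theory P by (rule P)
    show ?thesis using der
    proof induction
      case (hypothesis \<phi>)
      then show ?case using \<Gamma> by blast
    next
      case (axiom \<phi>)
      then show ?case
        using ax_MLL_subst[of UNIV \<sigma> \<phi>] ax_lattice_subst[of UNIV \<sigma> \<phi>] resolve_ax resolve_lattice_ax
        by blast
    next
      case (rule \<Delta> \<phi>)
      from rule.hyps consider
        \<psi> where "\<Delta> = {\<psi>, \<psi> \<rightarrow> \<phi>}" | \<psi> \<chi> where "\<Delta> = {\<psi>, \<chi>}" "\<phi> = \<psi> \<^bold>\<and> \<chi>"
        by (auto simp: rule_MP_def rule_adj_def)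
      then show ?case
      proof cases
        case 1
        then have "P (resolve P (subst \<sigma> \<psi>))" "P (resolve P (subst \<sigma> (\<psi> \<rightarrow> \<phi>)))"
          using rule.IH by blast+
        then show ?thesis by (simp only: subst.simps resolve.simps) (rule mp)
      next
        case 2
        then have "P (resolve P (subst \<sigma> \<psi>))" "P (resolve P (subst \<sigma> \<chi>))"
          using rule.IH by blast+
        then show ?thesis using 2 by simp
      qed
    qed
  qed
  then show "\<Gamma> \<turnstile>\<^bsub>chain_consequence A\<^esub> \<phi>" unfolding chain_consequence_def by blast
qed

text \<open>By leastness only the defining axioms need checking: \<open>linear\<close> yields
  prelinearity and \<open>complete\<close> yields excluded middle. So one complete theory can refute
  a disjunction.\<close>

lemma oplus_IULstar_chain_consequence:
  assumes A: "A \<subseteq> Fm_m"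
  shows "oplus Fm_l IULstar A \<subseteq> chain_consequence A"
proof -
  let ?L = "chain_consequence A"
  have valid: "{} \<turnstile>\<^bsub>?L\<^esub> \<phi>"
    if "\<And>P \<sigma>. complete_theory P \<Longrightarrow> (\<And>\<alpha>. \<alpha> \<in> mix_axioms A \<Longrightarrow> P \<alpha>) \<Longrightarrow> P (resolve P (subst \<sigma> \<phi>))" for \<phi>
    using that unfolding chain_consequence_def by blast
  have "{} \<turnstile>\<^bsub>?L\<^esub> (((Var 0 \<rightarrow> Var 1) \<^bold>\<and> \<one>) \<^bold>\<or> ((Var 1 \<rightarrow> Var 0) \<^bold>\<and> \<one>))"
  proof (rule valid)
    fix P and \<sigma> :: "nat \<Rightarrow> fm"
    assume "complete_theory P"
    then interpret complete_theory P .
    let ?a = "resolve P (\<sigma> 0)" and ?b = "resolve P (\<sigma> 1)"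
    \<comment> \<open>The value of the meet of \<open>x\<close> with \<open>\<one>\<close>. As
      \<open>\<one>\<close> is in \<open>P\<close>, this value is in \<open>P\<close> whenever
      \<open>x\<close> is.\<close>
    let ?m = "\<lambda>x. if P (x \<rightarrow> \<one>) then x else \<one>"
    have m: "P (?m x)" if "P x" for x using that one by simp
    have "P (?m (?a \<rightarrow> ?b)) \<or> P (?m (?b \<rightarrow> ?a))" using linear m by blast
    from max_intro[OF this]
    show "P (resolve P (subst \<sigma> (((Var 0 \<rightarrow> Var 1) \<^bold>\<and> \<one>) \<^bold>\<or> ((Var 1 \<rightarrow> Var 0) \<^bold>\<and> \<one>))))"
      by (simp only: subst.simps resolve.simps)
  qed
  then have "IULminus \<subseteq> ?L"
    unfolding IULminus_def
    by (intro oplus_least logic_over_chain_consequence MALLminus_chain_consequence) auto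
  moreover have "{} \<turnstile>\<^bsub>?L\<^esub> (Var 0 \<^bold>\<or> \<^bold>\<not> (Var 0))"
  proof (rule valid)
    fix P and \<sigma> :: "nat \<Rightarrow> fm"
    assume "complete_theory P"
    then interpret complete_theory P .
    show "P (resolve P (subst \<sigma> (Var 0 \<^bold>\<or> \<^bold>\<not> (Var 0))))"
      using max_intro[OF complete] by (simp only: subst.simps subst_defined resolve.simps resolve_Neg)
  qed
  moreover have "{} \<turnstile>\<^bsub>?L\<^esub> (\<zero> \<rightarrow> \<one>)"
    by (rule valid) (simp add: mix_axioms_def)
  ultimately have "IULstar \<subseteq> ?L"
    unfolding IULstar_def by (intro oplus_least logic_over_chain_consequence) auto
  moreover have "{} \<turnstile>\<^bsub>?L\<^esub> \<alpha>" if "\<alpha> \<in> A" for \<alpha>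
  proof (rule valid)
    fix P and \<sigma> :: "nat \<Rightarrow> fm"
    assume ax: "\<And>\<alpha>. \<alpha> \<in> mix_axioms A \<Longrightarrow> P \<alpha>"
    have "subst (resolve P \<circ> \<sigma>) \<alpha> \<in> mix_axioms A" using that unfolding mix_axioms_def by blast
    then show "P (resolve P (subst \<sigma> \<alpha>))"
      using ax resolve_subst[of \<alpha> P \<sigma>] that A by auto
  qed
  ultimately show ?thesis by (intro oplus_least logic_over_chain_consequence) auto
qed

section \<open>From disjunctions to nontrivial sums\<close>

lemma Plus_list_Fm_m:
  assumes "\<phi>s \<noteq> []" "set \<phi>s \<subseteq> Fm_m"
  shows "Plus_list \<phi>s \<in> Fm_m"
proof -
  have "a \<in> Fm_m \<Longrightarrow> set xs \<subseteq> Fm_m \<Longrightarrow> foldl Plus a xs \<in> Fm_m" for a xs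
    by (induction xs arbitrary: a) (simp_all add: Plus_def)
  then show ?thesis using assms by (cases \<phi>s) (auto simp: Plus_list_def)
qed

text \<open>If no nontrivial combination were derivable, a complete theory avoiding them all would
  refute the disjunction, as each disjunct already implies one. Placing the conclusion in the
  multiplicative logic serves both halves of the theorem.\<close>

lemma alternatives_of_disjunction:
  assumes A: "A \<subseteq> Fm_m"
    and power_hyp: "\<And>n \<psi>. n \<ge> n0 \<Longrightarrow>
      \<exists>m k. m \<ge> 1 \<and> mix_derives A {} (pow (mult n \<psi>) k \<rightarrow> mult m (pow \<psi> n))"
    and \<Sigma>: "\<Sigma> \<subseteq> Fm_m" and \<phi>s: "set \<phi>s \<subseteq> Fm_m" "\<phi>s \<noteq> []"
    and disj: "\<Sigma> \<turnstile>\<^bsub>oplus Fm_l IULstar A\<^esub> Disj_list \<phi>s"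
  shows "\<exists>ls. length ls = length \<phi>s \<and> (\<exists>l\<in>set ls. l \<noteq> 0) \<and>
    \<Sigma> \<turnstile>\<^bsub>oplus Fm_m MLL0u A\<^esub> Plus_list (map2 mult ls \<phi>s)"
proof -
  define ok where "ok ls \<longleftrightarrow> length ls = length \<phi>s \<and> (\<exists>l\<in>set ls. l \<noteq> (0::nat))" for ls
  \<comment> \<open>Formulas provably implying a combination, not the combinations themselves: a sum
    of two combinations is one only up to provable implication.\<close>
  define S where "S = {x. \<exists>ls. ok ls \<and> mix_derives A {} (x \<rightarrow> lincomb ls \<phi>s)}"
  interpret E: mll0 "mix_derives A {}" by (rule mll0_mix_derives)
  interpret D: mll0 "mix_derives A \<Sigma>" by (rule mll0_mix_derives)
  \<comment> \<open>Natural coefficients cannot cancel: a nonzero entry of \<open>ks\<close> stays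
    nonzero after adding \<open>ls\<close>.\<close>
  have ok_add: "ok (map2 (+) ks ls)" if kl: "ok ks" "ok ls" for ks ls
  proof -
    obtain l where "l \<in> set ks" "l \<noteq> 0" using kl(1) unfolding ok_def by blast
    then obtain i where i: "i < length \<phi>s" "ks ! i \<noteq> 0"
      using kl(1) by (auto simp: in_set_conv_nth ok_def)
    then have "map2 (+) ks ls ! i \<noteq> 0" using kl by (simp add: ok_def)
    moreover have "map2 (+) ks ls ! i \<in> set (map2 (+) ks ls)"
      using i kl by (intro nth_mem) (simp add: ok_def)
    ultimately have "\<exists>l\<in>set (map2 (+) ks ls). l \<noteq> 0" by blast
    then show ?thesis using kl unfolding ok_def by simp
  qed
  have "\<exists>s\<in>S. mix_derives A \<Sigma> s"
  proof (rule ccontr)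
    assume "\<not> ?thesis"
    then have avoid: "\<not> mix_derives A \<Sigma> s" if "s \<in> S" for s using that by blast
    have plus: "s \<^bold>+ t \<in> S" if st: "s \<in> S" "t \<in> S" for s t
    proof -
      obtain ks ls where "ok ks" "mix_derives A {} (s \<rightarrow> lincomb ks \<phi>s)"
        "ok ls" "mix_derives A {} (t \<rightarrow> lincomb ls \<phi>s)"
        using st unfolding S_def by blast
      then have "ok (map2 (+) ks ls)" "mix_derives A {} (s \<^bold>+ t \<rightarrow> lincomb (map2 (+) ks ls) \<phi>s)"
        using ok_add E.imp_trans[OF E.plus_mono E.lincomb_add] by (auto simp: ok_def)
      then show ?thesis unfolding S_def by blast
    qed
    have zero_plus: "\<zero> \<^bold>+ s \<in> S" if "s \<in> S" for s
      using that E.imp_trans[OF E.zero_plus] unfolding S_def by blast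
    obtain T where T: "\<Sigma> \<subseteq> T" "T \<inter> S = {}" "mix_axioms A \<subseteq> T" "complete_theory (\<lambda>\<phi>. \<phi> \<in> T)"
      by (rule complete_extension[OF power_hyp plus zero_plus avoid])
    let ?r = "resolve (\<lambda>\<phi>. \<phi> \<in> T)"
    have "\<Sigma> \<turnstile>\<^bsub>chain_consequence A\<^esub> Disj_list \<phi>s"
      using disj oplus_IULstar_chain_consequence[OF A] by blast
    then have "(\<forall>\<gamma>\<in>\<Sigma>. ?r (subst Var \<gamma>) \<in> T) \<Longrightarrow> ?r (subst Var (Disj_list \<phi>s)) \<in> T"
      using T(3,4) unfolding chain_consequence_def by blast
    moreover have "\<forall>\<gamma>\<in>\<Sigma>. ?r (subst Var \<gamma>) \<in> T" using T(1) \<Sigma> by (auto simp: resolve_Fm_m subset_iff)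
    ultimately have "?r (Disj_list \<phi>s) \<in> T" by simp
    then obtain \<phi> where "\<phi> \<in> set \<phi>s" "\<phi> \<in> T"
      using resolve_Disj_list[OF \<phi>s(2), of "\<lambda>\<phi>. \<phi> \<in> T"] \<phi>s(1)
      by (auto simp: resolve_Fm_m subset_iff)
    \<comment> \<open>A unit vector of coefficients puts the selected disjunct into
      \<open>S\<close>, which \<open>T\<close> avoids.\<close>
    moreover from this have "\<phi> \<in> S" using E.member_imp_lincomb unfolding S_def ok_def by blast
    ultimately show False using T(2) by blast
  qed
  then obtain s ls where s: "mix_derives A \<Sigma> s" "ok ls" "mix_derives A {} (s \<rightarrow> lincomb ls \<phi>s)"
    unfolding S_def by blast
  then have "mix_derives A \<Sigma> (lincomb ls \<phi>s)" using D.mp derives_mono by blast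
  then have "mix_derives A \<Sigma> (Plus_list (map2 mult ls \<phi>s))"
    using D.Plus_list_iff_lincomb s(2) \<phi>s(2) unfolding ok_def by blast
  moreover have "Plus_list (map2 mult ls \<phi>s) \<in> Fm_m"
  proof (rule Plus_list_Fm_m)
    show "map2 mult ls \<phi>s \<noteq> []" using s(2) \<phi>s(2) by (auto simp: ok_def)
    show "set (map2 mult ls \<phi>s) \<subseteq> Fm_m" using \<phi>s(1) by (auto intro!: mult_Fm_m dest: set_zip_rightD)
  qed
  ultimately show ?thesis
    using mix_derives_oplus_MLL0u[OF A \<Sigma>] s(2) unfolding ok_def by blast
qed

section \<open>The lattice logic and its multiplicative fragment\<close>

lemma iul_star_theory:
  assumes logic: "logic_over Fm_l L" and L: "IULstar \<subseteq> L"
  shows "iul_star (\<lambda>\<phi>. \<Gamma> \<turnstile>\<^bsub>L\<^esub> \<phi>)"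
proof -
  have "MALLminus \<subseteq> IULminus" "IULminus \<subseteq> IULstar"
    unfolding IULminus_def IULstar_def by (rule oplus_extends)+
  then have sub: "MALLminus \<subseteq> L" "IULminus \<subseteq> L" using L by blast+
  have ax: "\<Gamma> \<turnstile>\<^bsub>L\<^esub> \<phi>" if "\<phi> \<in> ax_MLL UNIV \<union> ax_lattice UNIV" for \<phi>
  proof -
    have "\<Gamma> \<turnstile>\<^bsub>MALLminus\<^esub> \<phi>"
      using that by (simp add: MALLminus_def axiomatized_def Fm_l_def derives.axiom)
    then show ?thesis using sub by blast
  qed
  have rule: "\<Gamma> \<turnstile>\<^bsub>L\<^esub> \<phi>"
    if "(\<Delta>, \<phi>) \<in> rule_MP UNIV \<union> rule_adj UNIV" "\<forall>\<psi>\<in>\<Delta>. \<Gamma> \<turnstile>\<^bsub>L\<^esub> \<psi>" for \<Delta> \<phi>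
  proof -
    have "derives (ax_MLL UNIV \<union> ax_lattice UNIV) (rule_MP UNIV \<union> rule_adj UNIV) \<Delta> \<phi>"
      using that(1) by (rule derives.rule) (rule derives.hypothesis)
    then have "\<Delta> \<turnstile>\<^bsub>MALLminus\<^esub> \<phi>" by (simp add: MALLminus_def axiomatized_def Fm_l_def)
    then have "\<Delta> \<turnstile>\<^bsub>L\<^esub> \<phi>" using sub by blast
    then show ?thesis using logic_over_cut[OF logic _ that(2)] by (simp add: Fm_l_def)
  qed
  have inst: "\<Gamma> \<turnstile>\<^bsub>L\<^esub> (subst \<sigma> \<phi>)" if "{} \<turnstile>\<^bsub>L\<^esub> \<phi>" for \<sigma> \<phi>
    using logic_over_mono[OF logic logic_over_subst[OF logic _ that]] by (simp add: Fm_l_def)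
  have star: "{} \<turnstile>\<^bsub>L\<^esub> \<phi>" if "\<phi> \<in> {Var 0 \<^bold>\<or> \<^bold>\<not> (Var 0), \<zero> \<rightarrow> \<one>}" for \<phi>
    using oplus_theorem[OF that] L unfolding IULstar_def by blast
  show ?thesis
  proof
    show "\<Gamma> \<turnstile>\<^bsub>L\<^esub> \<phi>" if "\<phi> \<in> ax_MLL UNIV" for \<phi> using that ax by blast
    show "\<Gamma> \<turnstile>\<^bsub>L\<^esub> \<phi>" if "\<phi> \<in> ax_lattice UNIV" for \<phi> using that ax by blast
    show "\<Gamma> \<turnstile>\<^bsub>L\<^esub> \<psi>" if "\<Gamma> \<turnstile>\<^bsub>L\<^esub> \<phi>" "\<Gamma> \<turnstile>\<^bsub>L\<^esub> (\<phi> \<rightarrow> \<psi>)" for \<phi> \<psi>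
      by (rule rule[of "{\<phi>, \<phi> \<rightarrow> \<psi>}"]) (use that in \<open>auto simp: rule_MP_def\<close>)
    show "\<Gamma> \<turnstile>\<^bsub>L\<^esub> (\<phi> \<^bold>\<and> \<psi>)" if "\<Gamma> \<turnstile>\<^bsub>L\<^esub> \<phi>" "\<Gamma> \<turnstile>\<^bsub>L\<^esub> \<psi>" for \<phi> \<psi>
      by (rule rule[of "{\<phi>, \<psi>}"]) (use that in \<open>auto simp: rule_adj_def\<close>)
    show "\<Gamma> \<turnstile>\<^bsub>L\<^esub> (\<zero> \<rightarrow> \<one>)" using inst[OF star, of "\<zero> \<rightarrow> \<one>" Var] by simp
    show "\<Gamma> \<turnstile>\<^bsub>L\<^esub> (\<phi> \<^bold>\<or> \<^bold>\<not> \<phi>)" for \<phi>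
      using inst[OF star, of "Var 0 \<^bold>\<or> \<^bold>\<not> (Var 0)" "\<lambda>_. \<phi>"] by simp
    have "{} \<turnstile>\<^bsub>IULminus\<^esub> (((Var 0 \<rightarrow> Var 1) \<^bold>\<and> \<one>) \<^bold>\<or> ((Var 1 \<rightarrow> Var 0) \<^bold>\<and> \<one>))"
      unfolding IULminus_def by (rule oplus_theorem) simp
    then have pre: "{} \<turnstile>\<^bsub>L\<^esub> (((Var 0 \<rightarrow> Var 1) \<^bold>\<and> \<one>) \<^bold>\<or> ((Var 1 \<rightarrow> Var 0) \<^bold>\<and> \<one>))"
      using sub by blast
    show "\<Gamma> \<turnstile>\<^bsub>L\<^esub> (((\<phi> \<rightarrow> \<psi>) \<^bold>\<and> \<one>) \<^bold>\<or> ((\<psi> \<rightarrow> \<phi>) \<^bold>\<and> \<one>))" for \<phi> \<psi>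
      using inst[OF pre, of "\<lambda>x. if x = 0 then \<phi> else \<psi>"] by simp
  qed
qed

lemma logic_over_mult_fragment:
  assumes "logic_over Fm_l L"
  shows "logic_over Fm_m (mult_fragment L)"
  unfolding logic_over_def
proof (intro conjI allI impI)
  fix \<Gamma> \<Delta> \<phi>
  assume "\<Gamma> \<subseteq> Fm_m" "\<forall>\<psi>\<in>\<Delta>. \<Gamma> \<turnstile>\<^bsub>mult_fragment L\<^esub> \<psi>" "\<Delta> \<turnstile>\<^bsub>mult_fragment L\<^esub> \<phi>"
  then show "\<Gamma> \<turnstile>\<^bsub>mult_fragment L\<^esub> \<phi>"
    using logic_over_cut[OF assms, of \<Gamma> \<Delta> \<phi>] by (auto simp: mult_fragment_def Fm_l_def)
next
  fix \<Gamma> \<phi> and \<sigma> :: "nat \<Rightarrow> fm"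
  assume "range \<sigma> \<subseteq> Fm_m" "\<Gamma> \<turnstile>\<^bsub>mult_fragment L\<^esub> \<phi>"
  then show "(subst \<sigma> ` \<Gamma>) \<turnstile>\<^bsub>mult_fragment L\<^esub> (subst \<sigma> \<phi>)"
    using logic_over_subst[OF assms, of \<sigma> \<Gamma> \<phi>] subst_Fm_m
    by (auto simp: mult_fragment_def Fm_l_def)
qed (use logic_over_refl[OF assms] logic_over_mono[OF assms] in
      \<open>auto simp: mult_fragment_def Fm_l_def\<close>)

text \<open>The rule from \<open>mult n \<phi>\<close> to \<open>\<phi>\<close> is
  \<open>alternatives\<close> for a one-element list.\<close>

lemma MLLu_mult_fragment:
  assumes logic: "logic_over Fm_l L" and L: "IULstar \<subseteq> L"
  shows "MLLu \<subseteq> mult_fragment L"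
proof clarify
  fix \<Gamma> \<phi>
  assume der: "\<Gamma> \<turnstile>\<^bsub>MLLu\<^esub> \<phi>"
  interpret iul_star "\<lambda>\<phi>. \<Gamma> \<turnstile>\<^bsub>L\<^esub> \<phi>" by (rule iul_star_theory[OF assms])
  have "derives (ax_MLL Fm_m) (rule_MP Fm_m \<union> rule_u Fm_m) \<Gamma> \<phi>"
    using der by (simp add: MLLu_def axiomatized_def)
  then have "\<Gamma> \<turnstile>\<^bsub>L\<^esub> \<phi>"
  proof induction
    case (hypothesis \<phi>)
    then show ?case using logic_over_refl[OF logic] by (simp add: Fm_l_def)
  next
    case (axiom \<phi>)
    then show ?case using ax ax_MLL_mono[of Fm_m UNIV] by blast
  next
    case (rule \<Delta> \<phi>)
    from rule.hyps consider \<psi> where "\<Delta> = {\<psi>, \<psi> \<rightarrow> \<phi>}" | n where "\<Delta> = {mult n \<phi>}" "n \<ge> 1"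
      by (auto simp: rule_MP_def rule_u_def)
    then show ?case
    proof cases
      case 1
      then show ?thesis using rule.IH mp by blast
    next
      case 2
      then have "\<Gamma> \<turnstile>\<^bsub>L\<^esub> mult n \<phi>" using rule.IH by blast
      then show ?thesis
        using alternatives[of "[n]" "[\<phi>]"] 2(2) by (simp add: Plus_list_def Disj_list_def)
    qed
  qed
  then show "\<Gamma> \<turnstile>\<^bsub>mult_fragment L\<^esub> \<phi>"
    using der logic_over_MLLu by (auto simp: mult_fragment_def logic_over_def)
qed

theorem theorem3p4:
  fixes A :: "fm set" and p :: nat
  assumes "A \<subseteq> Fm_m"
    and "\<exists>n0::nat. \<forall>n\<ge>n0. \<exists>m k :: nat. m \<ge> 1 \<and>
           {} \<turnstile>\<^bsub>oplus Fm_m MLL0 A\<^esub> (pow (mult n (Var p)) k \<rightarrow> mult m (pow (Var p) n))"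
  shows "admits_theorem_of_alternatives (oplus Fm_l IULstar A)
       \<and> mult_fragment (oplus Fm_l IULstar A) = oplus Fm_m MLL0u A"
proof -
  let ?L = "oplus Fm_l IULstar A" and ?M = "oplus Fm_m MLL0u A"
  have logic: "logic_over Fm_l ?L" by (rule logic_over_oplus) (auto simp: Fm_l_def)
  have ext: "IULstar \<subseteq> ?L" by (rule oplus_extends)
  obtain n0 where n0: "\<And>n. n \<ge> n0 \<Longrightarrow> \<exists>m k :: nat. m \<ge> 1 \<and>
      {} \<turnstile>\<^bsub>oplus Fm_m MLL0 A\<^esub> (pow (mult n (Var p)) k \<rightarrow> mult m (pow (Var p) n))"
    using assms(2) by blast
  have power_hyp: "\<exists>m k. m \<ge> 1 \<and> mix_derives A {} (pow (mult n \<psi>) k \<rightarrow> mult m (pow \<psi> n))"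
    if "n \<ge> n0" for n \<psi>
  proof -
    obtain m k where mk: "m \<ge> 1"
      "{} \<turnstile>\<^bsub>oplus Fm_m MLL0 A\<^esub> (pow (mult n (Var p)) k \<rightarrow> mult m (pow (Var p) n))"
      using n0[OF \<open>n \<ge> n0\<close>] by blast
    \<comment> \<open>Sending every variable to \<open>\<psi>\<close> turns the hypothesis on one
      variable into its instance at \<open>\<psi>\<close>.\<close>
    have "mix_derives A {} (pow (mult n \<psi>) k \<rightarrow> mult m (pow \<psi> n))"
      using mix_derives_subst[OF oplus_MLL0_mix_derives[OF assms(1) mk(2)], of "\<lambda>_. \<psi>"] by simp
    then show ?thesis using mk(1) by blast
  qed
  have alt: "\<exists>ls. length ls = length \<phi>s \<and> (\<exists>l\<in>set ls. l \<noteq> 0) \<and>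
      \<Sigma> \<turnstile>\<^bsub>?M\<^esub> Plus_list (map2 mult ls \<phi>s)"
    if "\<Sigma> \<subseteq> Fm_m" "set \<phi>s \<subseteq> Fm_m" "\<phi>s \<noteq> []" "\<Sigma> \<turnstile>\<^bsub>?L\<^esub> Disj_list \<phi>s" for \<Sigma> \<phi>s
    by (rule alternatives_of_disjunction[OF assms(1) power_hyp that])
  have "?M \<subseteq> mult_fragment ?L"
  proof (rule oplus_least)
    have "{} \<turnstile>\<^bsub>?L\<^esub> (\<zero> \<rightarrow> \<one>)"
      using oplus_theorem[of "\<zero> \<rightarrow> \<one>" "{Var 0 \<^bold>\<or> \<^bold>\<not> (Var 0), \<zero> \<rightarrow> \<one>}" Fm_l IULminus] ext
      unfolding IULstar_def by auto
    then show "MLL0u \<subseteq> mult_fragment ?L"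
      unfolding MLL0u_def
      by (intro oplus_least logic_over_mult_fragment[OF logic] MLLu_mult_fragment[OF logic ext])
        (simp add: mult_fragment_def)
    show "{} \<turnstile>\<^bsub>mult_fragment ?L\<^esub> \<phi>" if "\<phi> \<in> A" for \<phi>
      using that assms(1) oplus_theorem[OF that] by (auto simp: mult_fragment_def)
  qed (rule logic_over_mult_fragment[OF logic])
  \<comment> \<open>Lets the sums found in \<open>?M\<close> count as derivable in
    \<open>?L\<close>, as the theorem of alternatives requires.\<close>
  then have M_L: "?M \<subseteq> ?L" by (auto simp: mult_fragment_def)
  \<comment> \<open>A one-element disjunction is the formula itself, so \<open>alt\<close> gives a
    positive multiple of it in \<open>?M\<close>, and the rule for multiples recovers the
    formula.\<close>
  moreover have "mult_fragment ?L \<subseteq> ?M"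
  proof clarify
    fix \<Sigma> \<phi>
    assume "\<Sigma> \<turnstile>\<^bsub>mult_fragment ?L\<^esub> \<phi>"
    then have \<Sigma>: "\<Sigma> \<subseteq> Fm_m" "\<phi> \<in> Fm_m" "\<Sigma> \<turnstile>\<^bsub>?L\<^esub> Disj_list [\<phi>]"
      by (auto simp: mult_fragment_def Disj_list_def)
    then obtain ls where "length ls = length [\<phi>]" "\<exists>l\<in>set ls. l \<noteq> 0"
      "\<Sigma> \<turnstile>\<^bsub>?M\<^esub> Plus_list (map2 mult ls [\<phi>])"
      using alt[of \<Sigma> "[\<phi>]"] by auto
    then obtain n where n: "n \<ge> 1" "\<Sigma> \<turnstile>\<^bsub>?M\<^esub> mult n \<phi>"
      by (cases ls) (auto simp: Plus_list_def Suc_le_eq)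
    have "({mult n \<phi>}, \<phi>) \<in> rule_MP Fm_m \<union> rule_u Fm_m"
      using n(1) \<Sigma>(2) by (auto simp: rule_u_def)
    then have "derives (ax_MLL Fm_m) (rule_MP Fm_m \<union> rule_u Fm_m) {mult n \<phi>} \<phi>"
      by (rule derives.rule) (rule derives.hypothesis)
    then have "{mult n \<phi>} \<turnstile>\<^bsub>MLLu\<^esub> \<phi>"
      using \<Sigma>(2) by (simp add: MLLu_def axiomatized_def mult_Fm_m)
    moreover have "MLLu \<subseteq> ?M" using oplus_extends unfolding MLL0u_def by blast
    ultimately have "{mult n \<phi>} \<turnstile>\<^bsub>?M\<^esub> \<phi>" by blast
    then show "\<Sigma> \<turnstile>\<^bsub>?M\<^esub> \<phi>"
      using logic_over_cut[OF logic_over_oplus_MLL0u[OF assms(1)] \<Sigma>(1), of "{mult n \<phi>}"] n(2) by simp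
  qed
  moreover have "admits_theorem_of_alternatives ?L"
    unfolding admits_theorem_of_alternatives_def
  proof (intro allI impI iffI)
    fix \<Sigma> \<phi>s
    assume "\<Sigma> \<subseteq> Fm_m" "set \<phi>s \<subseteq> Fm_m" "\<phi>s \<noteq> []" "\<Sigma> \<turnstile>\<^bsub>?L\<^esub> Disj_list \<phi>s"
    then show "\<exists>ls. length ls = length \<phi>s \<and> (\<exists>l\<in>set ls. l \<noteq> 0) \<and>
        \<Sigma> \<turnstile>\<^bsub>?L\<^esub> Plus_list (map2 mult ls \<phi>s)"
      using alt[of \<Sigma> \<phi>s] M_L by blast
  next
    fix \<Sigma> \<phi>s
    assume "\<exists>ls. length ls = length \<phi>s \<and> (\<exists>l\<in>set ls. l \<noteq> 0) \<and>
        \<Sigma> \<turnstile>\<^bsub>?L\<^esub> Plus_list (map2 mult ls \<phi>s)"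
    then show "\<Sigma> \<turnstile>\<^bsub>?L\<^esub> Disj_list \<phi>s"
      using iul_star.alternatives[OF iul_star_theory[OF logic ext]] by blast
  qed
  ultimately show ?thesis using \<open>?M \<subseteq> mult_fragment ?L\<close> by blast
qed

end
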